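(* Let $\mathbb{F}$ be a local field and $n$ a positive integer. If $Z(\mathrm{SL}(n,\mathbb{F}))\subseteq\{I,-I\}$, then for every topological subfield $H$ of $\mathbb{F}$ the groups $\mathrm{PSL}(n,H)$ and $\mathrm{SL}(n,H)$ are totally minimal. In particular: (1) for every local field $\mathbb{F}$, $\mathrm{SL}(2,H)$ and $\mathrm{PSL}(2,H)$ are totally minimal for every topological subfield $H$ of $\mathbb{F}$; (2) for every positive integer $n$, $\mathrm{SL}(n,H)$ and $\mathrm{PSL}(n,H)$ are totally minimal for every topological subfield $H$ of $\mathbb{R}$.
   Context: A local field is a non-discrete locally compact (Hausdorff) topological field; no restriction on the characteristic is made. A topological subfield carries the inherited topology. $\mathrm{SL}(n,H)$ is the group of $n\times n$ matrices over $H$ of determinant $1$ with the pointwise topology inherited from $H^{n^2}$; $Z(G)$ denotes the center of $G$; $\mathrm{PSL}(n,H)=\mathrm{SL}(n,H)/Z(\mathrm{SL}(n,H))$ has the quotient topology. All topological groups are Hausdorff. A topological group is minimal if it admits no strictly coarser Hausdorff group topology; $G$ is totally minimal if every Hausdorff quotient group $G/N$ ($N$ a closed normal subgroup) is minimal. *)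

theory Defs
  imports "HOL-Analysis.Analysis" "HOL-Algebra.Algebraic_Closure_Type"
begin

section \<open>Local fields\<close>

class topological_field =
  field + topological_ab_group_add + topological_semigroup_mult +
  assumes tendsto_inverse_nhds: "a \<noteq> 0 \<Longrightarrow> filterlim inverse (nhds (inverse a)) (nhds a)"

class local_field = topological_field + t2_space +
  assumes locally_compact: "\<exists>U K. open U \<and> compact K \<and> x \<in> U \<and> U \<subseteq> K"
    and not_discrete: "\<exists>S. \<not> open S"

instance real :: local_field
proof
  show "filterlim inverse (nhds (inverse a)) (nhds a)" if "a \<noteq> 0" for a :: real
    using that by (intro tendsto_inverse filterlim_ident)
  show "\<exists>U K. open U \<and> compact K \<and> x \<in> U \<and> U \<subseteq> K" for x :: real
    by (intro exI[of _ "ball x 1"] exI[of _ "cball x 1"]) auto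
  show "\<exists>S :: real set. \<not> open S"
    using not_open_singleton by blast
qed


section \<open>Minimal and totally minimal topological groups\<close>

definition hausdorff_topological_group :: "('g, 'b) monoid_scheme \<Rightarrow> 'g topology \<Rightarrow> bool" where
  "hausdorff_topological_group G T \<longleftrightarrow>
     group G \<and> topspace T = carrier G \<and> Hausdorff_space T \<and>
     continuous_map (prod_topology T T) T (\<lambda>(x, y). x \<otimes>\<^bsub>G\<^esub> y) \<and>
     continuous_map T T (\<lambda>x. inv\<^bsub>G\<^esub> x)"

definition minimal_group :: "('g, 'b) monoid_scheme \<Rightarrow> 'g topology \<Rightarrow> bool" where
  "minimal_group G T \<longleftrightarrow>
     hausdorff_topological_group G T \<and>
     (\<forall>T'. hausdorff_topological_group G T' \<and> (\<forall>U. openin T' U \<longrightarrow> openin T U) \<longrightarrow> T' = T)"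

definition quotient_topology :: "'g topology \<Rightarrow> ('g \<Rightarrow> 'h) \<Rightarrow> 'h topology" where
  "quotient_topology T f =
     topology (\<lambda>U. U \<subseteq> f ` topspace T \<and> openin T {x \<in> topspace T. f x \<in> U})"

lemma openin_quotient_topology:
  "openin (quotient_topology T f) U \<longleftrightarrow>
     U \<subseteq> f ` topspace T \<and> openin T {x \<in> topspace T. f x \<in> U}"
proof -
  have "istopology (\<lambda>U. U \<subseteq> f ` topspace T \<and> openin T {x \<in> topspace T. f x \<in> U})"
    unfolding istopology_def
  proof (intro conjI allI impI)
    fix S U
    assume S: "S \<subseteq> f ` topspace T \<and> openin T {x \<in> topspace T. f x \<in> S}"
      and U: "U \<subseteq> f ` topspace T \<and> openin T {x \<in> topspace T. f x \<in> U}"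
    have "{x \<in> topspace T. f x \<in> S \<inter> U}
        = {x \<in> topspace T. f x \<in> S} \<inter> {x \<in> topspace T. f x \<in> U}"
      by blast
    then show "openin T {x \<in> topspace T. f x \<in> S \<inter> U}"
      using S U by auto
    show "S \<inter> U \<subseteq> f ` topspace T"
      using S by blast
  next
    fix K
    assume K: "\<forall>S\<in>K. S \<subseteq> f ` topspace T \<and> openin T {x \<in> topspace T. f x \<in> S}"
    have "{x \<in> topspace T. f x \<in> \<Union>K} = (\<Union>S\<in>K. {x \<in> topspace T. f x \<in> S})"
      by blast
    then show "openin T {x \<in> topspace T. f x \<in> \<Union>K}"
      using K by auto
    show "\<Union>K \<subseteq> f ` topspace T"
      using K by blast
  qed
  then show ?thesis
    by (simp add: quotient_topology_def topology_inverse')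
qed

lemma topspace_quotient_topology: "topspace (quotient_topology T f) = f ` topspace T"
proof -
  have "{x \<in> topspace T. f x \<in> f ` topspace T} = topspace T"
    by blast
  then have "openin (quotient_topology T f) (f ` topspace T)"
    by (simp add: openin_quotient_topology)
  then show ?thesis
    by (metis openin_quotient_topology openin_subset openin_topspace subset_antisym)
qed

lemma quotient_map_quotient_topology: "quotient_map T (quotient_topology T f) f"
  by (auto simp: quotient_map_def topspace_quotient_topology openin_quotient_topology)

abbreviation quotient_group_topology ::
    "('g, 'b) monoid_scheme \<Rightarrow> 'g topology \<Rightarrow> 'g set \<Rightarrow> 'g set topology" where
  "quotient_group_topology G T N \<equiv> quotient_topology T (\<lambda>g. N #>\<^bsub>G\<^esub> g)"

(* For a topological group, G / N is Hausdorff exactly when N is closed. *)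
definition totally_minimal_group :: "('g, 'b) monoid_scheme \<Rightarrow> 'g topology \<Rightarrow> bool" where
  "totally_minimal_group G T \<longleftrightarrow>
     hausdorff_topological_group G T \<and>
     (\<forall>N. N \<lhd> G \<and> closedin T N \<longrightarrow> minimal_group (G Mod N) (quotient_group_topology G T N))"


section \<open>Special linear groups\<close>

definition group_center :: "('g, 'b) monoid_scheme \<Rightarrow> 'g set" where
  "group_center G = {z \<in> carrier G. \<forall>g \<in> carrier G. z \<otimes>\<^bsub>G\<^esub> g = g \<otimes>\<^bsub>G\<^esub> z}"

definition SL :: "'a::field set \<Rightarrow> ('a^'n^'n) monoid" where
  "SL H = \<lparr> carrier = {A. (\<forall>i j. A $ i $ j \<in> H) \<and> det A = 1},
            monoid.mult = (\<lambda>A B. A ** B), one = mat 1 \<rparr>"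

(* The topology of the type of matrices is the product topology, so this is the topology
   of pointwise convergence, with H carrying the subspace topology. *)
definition SL_topology :: "'a::topological_field set \<Rightarrow> ('a^'n^'n) topology" where
  "SL_topology H = top_of_set (carrier (SL H))"

definition PSL :: "'a::field set \<Rightarrow> ('a^'n^'n) set monoid" where
  "PSL H = SL H Mod group_center (SL H)"

definition PSL_topology :: "'a::topological_field set \<Rightarrow> ('a^'n^'n) set topology" where
  "PSL_topology H = quotient_group_topology (SL H) (SL_topology H) (group_center (SL H))"

end

theory Submission
  imports Defs
begin

no_notation fps_nth (infixl "$" 75)

text \<open>
  Let \<open>G = SL(n, H)\<close> carry a coarser, possibly non-Hausdorff, group topology, and let \<open>N\<close> be
  the closure of the identity in it. If some neighbourhood of \<open>1\<close> is bounded in the matrices over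
  the local field, then the intersection of the closures of all neighbourhoods there is a bounded set
  normalised by \<open>G\<close>. Conjugation by transvections shows that such a set consists of scalars; by the
  hypothesis on the center these are \<open>\<plusminus> 1 \<in> G\<close>, so the intersection is \<open>N\<close>, and by compactness
  every open set containing \<open>N\<close> contains a neighbourhood. If no neighbourhood is bounded, then the
  matrices \<open>x E\<^sub>i\<^sub>j x\<^sup>-\<^sup>1\<close>, with \<open>x\<close> in a neighbourhood, are unbounded, which forces \<open>N\<close>
  to contain a root group, and hence \<open>N = G\<close>. In both cases the coarser topology is pulled back
  from the quotient topology on \<open>G / N\<close>.
\<close>

section \<open>Local fields\<close>

text \<open>A coarser Hausdorff group topology on a quotient is pulled back to \<open>G\<close>,
  where it fails to be Hausdorff as soon as the kernel is nontrivial. This treats all closed normal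
  subgroups at once, and the quotients of PSL with them, without any classification of normal
  subgroups. Compactness cannot be sought in \<open>G\<close>, since \<open>H\<close> need be
  neither closed nor locally compact; it is taken in the matrices over the whole field, and the
  price is that limits may leave \<open>G\<close>. Limits that are only known to be scalars have to
  be brought back into \<open>G\<close>: this works for \<plusminus> 1, which lie in every subfield,
  whereas another n-th root of unity may lie outside \<open>H\<close>. The field carries a topology
  but no absolute value, so boundedness means containment in a compact set, and comparing entries or
  dividing by a large entry rests on an element \<open>t\<close> whose powers contract a compact
  neighbourhood of 0. A finite \<open>H\<close> is treated apart, because \<open>H\<close> has
  arbitrarily small nonzero elements only when it is infinite.\<close>

instance topological_field < topological_comm_monoid_mult ..

lemma continuous_on_inverse_field:
  fixes f :: "'b::topological_space \<Rightarrow> 'a::topological_field"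
  assumes "continuous_on S f" "\<And>x. x \<in> S \<Longrightarrow> f x \<noteq> 0"
  shows "continuous_on S (\<lambda>x. inverse (f x))"
  unfolding continuous_on_def
proof
  fix x assume x: "x \<in> S"
  show "((\<lambda>x. inverse (f x)) \<longlongrightarrow> inverse (f x)) (at x within S)"
    by (rule filterlim_compose[OF tendsto_inverse_nhds])
      (use assms x in \<open>auto simp: continuous_on_def\<close>)
qed

text \<open>Stands for boundedness. The compact set lies in the whole space, so that subsets of a
  subfield that is not closed can be bounded too.\<close>

definition relcompact :: "'a::topological_space set \<Rightarrow> bool" where
  "relcompact A \<longleftrightarrow> (\<exists>C. compact C \<and> A \<subseteq> C)"

lemma relcompactI: "compact C \<Longrightarrow> A \<subseteq> C \<Longrightarrow> relcompact A"
  by (auto simp: relcompact_def)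

lemma relcompact_subset: "relcompact B \<Longrightarrow> A \<subseteq> B \<Longrightarrow> relcompact A"
  by (meson relcompact_def order_trans)

lemma relcompact_Un: "relcompact A \<Longrightarrow> relcompact B \<Longrightarrow> relcompact (A \<union> B)"
  unfolding relcompact_def by (meson compact_Un Un_mono)

lemma relcompact_finite: "finite A \<Longrightarrow> relcompact A"
  by (auto intro!: relcompactI finite_imp_compact)

lemma relcompact_UN:
  "finite I \<Longrightarrow> (\<And>i. i \<in> I \<Longrightarrow> relcompact (A i)) \<Longrightarrow> relcompact (\<Union>i\<in>I. A i)"
  by (induction I rule: finite_induct) (auto intro: relcompact_Un relcompact_finite)

lemma compact_times_image:
  fixes A B :: "'a::topological_field set"
  assumes "compact A" "compact B"
  shows "compact ((\<lambda>(x, y). x * y) ` (A \<times> B))"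
  by (rule compact_continuous_image)
    (auto simp: case_prod_unfold intro!: continuous_intros compact_Times assms)

lemma compact_inverse_image:
  fixes A :: "'a::topological_field set"
  assumes "compact A" "0 \<notin> A"
  shows "compact (inverse ` A)"
  by (rule compact_continuous_image)
    (use assms in \<open>auto intro!: continuous_on_inverse_field continuous_on_id\<close>)

lemma compact_scale:
  fixes A :: "'a::topological_field set"
  shows "compact A \<Longrightarrow> compact ((*) c ` A)"
  by (rule compact_continuous_image) (auto intro!: continuous_intros)

text \<open>If no member lay in \<open>U\<close>, the compact set \<open>A0 - U\<close> would meet
  every finite intersection of members, since directedness puts a member below each of them; it
  would then meet \<open>\<Inter>F\<close>, which lies in \<open>U\<close>.\<close>

lemma compact_directed_subset:
  fixes F :: "'a::t2_space set set"
  assumes "\<And>A. A \<in> F \<Longrightarrow> compact A" "F \<noteq> {}"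
    and dir: "\<And>A B. A \<in> F \<Longrightarrow> B \<in> F \<Longrightarrow> \<exists>D\<in>F. D \<subseteq> A \<inter> B"
    and "open U" "\<Inter>F \<subseteq> U"
  shows "\<exists>A\<in>F. A \<subseteq> U"
proof (rule ccontr)
  assume no: "\<not> ?thesis"
  obtain A0 where A0: "A0 \<in> F" using assms by blast
  have fin: "\<exists>D\<in>F. D \<subseteq> A0 \<inter> \<Inter>F'" if "finite F'" "F' \<subseteq> F" for F'
    using that
  proof (induction F' rule: finite_induct)
    case empty then show ?case using A0 by auto
  next
    case (insert A F')
    then obtain D where D: "D \<in> F" "D \<subseteq> A0 \<inter> \<Inter>F'" by auto
    obtain E where E: "E \<in> F" "E \<subseteq> D \<inter> A" using dir[of D A] D(1) insert.prems by auto
    have "E \<subseteq> A0 \<inter> \<Inter> (insert A F')"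
      using E(2) D(2) by auto
    with E(1) show ?case by (rule rev_bexI)
  qed
  have "(A0 - U) \<inter> \<Inter>F \<noteq> {}"
  proof (rule compact_imp_fip)
    show "compact (A0 - U)" using assms A0 by (simp add: compact_diff)
    fix F' assume "finite F'" "F' \<subseteq> F"
    then obtain D where "D \<in> F" "D \<subseteq> A0 \<inter> \<Inter>F'" using fin[of F'] by auto
    moreover from this no have "\<not> D \<subseteq> U" by simp
    then obtain x where "x \<in> D" "x \<notin> U" by auto
    ultimately have "x \<in> (A0 - U) \<inter> \<Inter>F'" by auto
    then show "(A0 - U) \<inter> \<Inter>F' \<noteq> {}" by (metis empty_iff)
  qed (use assms(1) compact_imp_closed in auto)
  with \<open>\<Inter>F \<subseteq> U\<close> show False by auto
qed

lemma nhd_mult_compact: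
  fixes f :: "'b::topological_space \<times> 'c::topological_space \<Rightarrow> 'd::topological_space"
  assumes "compact C" "continuous_on UNIV f" "open U" "\<And>c. c \<in> C \<Longrightarrow> f (a, c) \<in> U"
  obtains W where "open W" "a \<in> W" "\<And>w c. w \<in> W \<Longrightarrow> c \<in> C \<Longrightarrow> f (w, c) \<in> U"
proof -
  have op: "open (f -` U)"
    using assms by (simp add: open_vimage)
  have "{a} \<times> C \<subseteq> f -` U"
    using assms by auto
  from Elementary_Topology.tube_lemma[OF \<open>compact C\<close> op this] show ?thesis
    using that by blast
qed

text \<open>Takes the place of the estimate that a small factor times a bounded factor is small; the
  uniformity in \<open>c\<close> is the tube lemma.\<close>

lemma nhd_zero_times_compact:
  fixes C U :: "'a::topological_field set"
  assumes "compact C" "open U" "0 \<in> U"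
  obtains W where "open W" "0 \<in> W" "\<And>w c. w \<in> W \<Longrightarrow> c \<in> C \<Longrightarrow> w * c \<in> U"
  by (rule nhd_mult_compact[of C "\<lambda>(x, y). x * y" U 0])
    (use assms in \<open>auto simp: case_prod_unfold intro!: continuous_intros\<close>)

lemma not_open_zero: "\<not> open {0 :: 'a::local_field}"
proof
  assume op: "open {0 :: 'a}"
  have "open {x :: 'a}" for x
  proof -
    have "open ((\<lambda>y. y - x) -` {0})"
      by (rule open_vimage[OF op]) (intro continuous_intros)
    moreover have "(\<lambda>y. y - x) -` {0} = {x}" by auto
    ultimately show ?thesis by simp
  qed
  then have "open S" for S :: "'a set"
    by (metis UN_singleton open_UN)
  then show False using not_discrete by blast
qed

lemma nonzero_in_nhd_zero:
  fixes U :: "'a::local_field set"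
  assumes "open U" "0 \<in> U"
  obtains u where "u \<in> U" "u \<noteq> 0"
proof -
  have "U \<noteq> {0}" using assms not_open_zero by blast
  with assms that show ?thesis by blast
qed

text \<open>The powers have a cluster point, and two powers close to it have a quotient close to 1.
  The bounded inverse powers keep the cluster point away from 0, where division is not
  continuous.\<close>

lemma power_recurrent:
  fixes t :: "'a::local_field"
  assumes "t \<noteq> 0" and C: "compact C" "\<And>n. t ^ n \<in> C" "\<And>n. inverse (t ^ n) \<in> C"
    and U: "open U" "1 \<in> U"
  shows "\<exists>n\<ge>1. t ^ n \<in> U"
proof -
  define F where "F = filtermap (\<lambda>n. t ^ n) sequentially"
  have F: "F \<noteq> bot" "eventually (\<lambda>x. x \<in> C) F"
    using C by (simp_all add: F_def filtermap_bot_iff eventually_filtermap)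
  obtain c where c: "inf (nhds c) F \<noteq> bot"
    using compact_filter[THEN iffD1, rule_format, OF C(1) F] by blast
  have freq: "\<exists>n\<ge>m. t ^ n \<in> V" if "open V" "c \<in> V" for V m
  proof (rule ccontr)
    assume no: "\<not> ?thesis"
    have "eventually (\<lambda>x. x \<in> V) (nhds c)"
      using that eventually_nhds by blast
    moreover have "eventually (\<lambda>x. x \<notin> V) F"
      using no by (auto simp: F_def eventually_filtermap eventually_sequentially)
    ultimately have "eventually (\<lambda>x. False) (inf (nhds c) F)"
      unfolding eventually_inf
      by (intro exI[of _ "\<lambda>x. x \<in> V"] exI[of _ "\<lambda>x. x \<notin> V"]) simp
    with c show False by (simp add: trivial_limit_def)
  qed
  have "c \<noteq> 0"
  proof
    assume "c = 0"
    obtain W :: "'a set" where W: "open W" "0 \<in> W" "\<And>w c. w \<in> W \<Longrightarrow> c \<in> C \<Longrightarrow> w * c \<in> - {1}"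
      using nhd_zero_times_compact[OF C(1), of "- {1}"] by auto
    then obtain n where "t ^ n \<in> W" using freq[of W 0] \<open>c = 0\<close> by auto
    from W(3)[OF this C(3)[of n]] \<open>t \<noteq> 0\<close> show False by simp
  qed
  have "open {p \<in> UNIV \<times> - {0::'a}. fst p * inverse (snd p) \<in> U}"
  proof -
    have "open (UNIV \<times> - {0::'a})" by (intro open_Times) auto
    moreover have "continuous_on (UNIV \<times> - {0::'a}) (\<lambda>p. fst p * inverse (snd p))"
      by (intro continuous_intros continuous_on_inverse_field) auto
    ultimately have "open ((\<lambda>p. fst p * inverse (snd p)) -` U \<inter> (UNIV \<times> - {0::'a}))"
      using continuous_on_open_vimage U(1) by blast
    moreover have "{p \<in> UNIV \<times> - {0::'a}. fst p * inverse (snd p) \<in> U} =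
        (\<lambda>p. fst p * inverse (snd p)) -` U \<inter> (UNIV \<times> - {0::'a})"
      by auto
    ultimately show ?thesis by simp
  qed
  moreover have "(c, c) \<in> {p \<in> UNIV \<times> - {0::'a}. fst p * inverse (snd p) \<in> U}"
    using \<open>c \<noteq> 0\<close> U by simp
  ultimately obtain A B where AB: "open A" "open B" "c \<in> A" "c \<in> B"
    "A \<times> B \<subseteq> {p \<in> UNIV \<times> - {0::'a}. fst p * inverse (snd p) \<in> U}"
    by (rule open_prod_elim[of _ "(c, c)"]) auto
  obtain m where m: "t ^ m \<in> B" using freq AB by blast
  \<comment> \<open>\<open>Suc m\<close> rather than \<open>m\<close> makes the exponent
    \<open>n - m\<close> of the quotient positive.\<close>
  obtain n where n: "n \<ge> Suc m" "t ^ n \<in> A" using freq AB by blast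
  have "t ^ n * inverse (t ^ m) \<in> U" using AB m n by auto
  moreover have "t ^ n * inverse (t ^ m) = t ^ (n - m)"
    using n \<open>t \<noteq> 0\<close> by (simp add: power_diff divide_inverse)
  ultimately show ?thesis using n by (intro exI[of _ "n - m"]) auto
qed

text \<open>Multiplication by a small \<open>t\<close> maps \<open>K\<close> into itself and misses
  a point \<open>k\<close> of \<open>K\<close>. The compact sets \<open>t^n K\<close> decrease. A
  nonzero \<open>z\<close> in all of them would bound the powers of \<open>t\<close> in both
  directions; by recurrence some \<open>t^n k\<close> with \<open>n \<ge> 1\<close> would then avoid
  the closed set \<open>t K\<close>, in which it lies.\<close>

lemma ex_contraction:
  "\<exists>(t :: 'a::local_field) K U0. t \<noteq> 0 \<and> compact K \<and> open U0 \<and> 0 \<in> U0 \<and> U0 \<subseteq> K \<and>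
    (\<forall>x\<in>K. t * x \<in> K) \<and> (\<forall>U. open U \<longrightarrow> 0 \<in> U \<longrightarrow> (\<exists>n. \<forall>x\<in>K. t ^ n * x \<in> U))"
proof -
  obtain U0 K :: "'a set" where K: "open U0" "compact K" "0 \<in> U0" "U0 \<subseteq> K"
    using locally_compact by blast
  obtain k where k: "k \<in> U0" "k \<noteq> 0" using nonzero_in_nhd_zero[OF K(1,3)] by blast
  obtain W where W: "open W" "0 \<in> W" "\<And>w c. w \<in> W \<Longrightarrow> c \<in> K \<Longrightarrow> w * c \<in> U0 - {k}"
  proof (rule nhd_zero_times_compact[of K "U0 - {k}"])
    show "open (U0 - {k})" using K by (simp add: open_delete)
  qed (use K k in auto)
  obtain t where t: "t \<in> W" "t \<noteq> 0" using nonzero_in_nhd_zero[OF W(1,2)] by blast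
  have tK: "t * x \<in> K - {k}" if "x \<in> K" for x
    using W(3)[OF t(1) that] K by blast
  define L where "L n = (*) (t ^ n) ` K" for n
  have L_dec: "L (Suc n) \<subseteq> L n" for n
  proof
    fix z assume "z \<in> L (Suc n)"
    then obtain x where x: "x \<in> K" "z = t ^ Suc n * x" unfolding L_def by blast
    then have "z = t ^ n * (t * x)" by (simp add: mult_ac)
    with tK[OF x(1)] show "z \<in> L n" unfolding L_def by blast
  qed
  have L_anti: "L n \<subseteq> L m" if "m \<le> n" for m n
    using L_dec that by (rule lift_Suc_antimono_le)
  have L_compact: "compact (L n)" for n
    unfolding L_def using K(2) by (rule compact_scale)
  have L0: "z = 0" if z: "\<And>n. z \<in> L n" for z
  proof (rule ccontr)
    assume "z \<noteq> 0"
    have 1: "inverse (t ^ n) * z \<in> K" for n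
    proof -
      obtain x where "x \<in> K" "z = t ^ n * x" using z[of n] unfolding L_def by blast
      then have "inverse (t ^ n) * z = x" using t by (simp add: mult.assoc[symmetric])
      then show ?thesis using \<open>x \<in> K\<close> by simp
    qed
    have 2: "t ^ n * z \<in> K" for n
    proof (induction n)
      case 0 then show ?case using z[of 0] by (auto simp: L_def)
    next
      case (Suc n) then show ?case using tK[OF Suc] by (simp add: mult_ac)
    qed
    define C where "C = (*) (inverse z) ` K"
    have C: "compact C" unfolding C_def using K by (intro compact_scale)
    have inC: "y \<in> C" if "y * z \<in> K" for y
    proof -
      have "y = inverse z * (y * z)" using \<open>z \<noteq> 0\<close> by simp
      with that show ?thesis unfolding C_def by blast
    qed
    have nth: "\<not> k \<in> (*) t ` K" using tK by blast
    have "closed ((*) t ` K)"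
      using K by (intro compact_imp_closed compact_scale)
    then have "open ((\<lambda>x. x * k) -` (- (*) t ` K))"
      by (intro open_vimage) (auto intro!: continuous_intros)
    moreover have "1 \<in> (\<lambda>x. x * k) -` (- (*) t ` K)" using nth by simp
    ultimately obtain n where n: "n \<ge> 1" "t ^ n * k \<notin> (*) t ` K"
      using power_recurrent[OF t(2) C inC[OF 2] inC[OF 1], of "(\<lambda>x. x * k) -` (- (*) t ` K)"] by auto
    have "t ^ m * k \<in> K" for m
    proof (induction m)
      case 0 then show ?case using k K by auto
    next
      case (Suc m) then show ?case using tK[OF Suc] by (simp add: mult_ac)
    qed
    from this[of "n - 1"] n(2) have "t ^ n * k \<noteq> t * (t ^ (n - 1) * k)" by blast
    with n(1) show False by (cases n) (auto simp: mult_ac)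
  qed
  have main: "\<exists>n. \<forall>x\<in>K. t ^ n * x \<in> U" if U: "open U" "0 \<in> U" for U
  proof -
    have "\<exists>A\<in>range L. A \<subseteq> U"
    proof (rule compact_directed_subset)
      show "\<exists>D\<in>range L. D \<subseteq> A \<inter> B" if "A \<in> range L" "B \<in> range L" for A B
      proof -
        obtain m n where "A = L m" "B = L n" using \<open>A \<in> range L\<close> \<open>B \<in> range L\<close> by blast
        with L_anti[of m "max m n"] L_anti[of n "max m n"] show ?thesis by auto
      qed
      show "\<Inter> (range L) \<subseteq> U" using L0 U by blast
    qed (use L_compact U in auto)
    then show ?thesis unfolding L_def by blast
  qed
  show ?thesis
    by (rule exI[of _ t], rule exI[of _ K], rule exI[of _ U0]) (use t K tK main in auto)
qed


text \<open>Powers of a contraction \<open>t\<close> bring a multiple of \<open>1 / z\<close> into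
  \<open>K\<close>; stopped at the first such exponent, they land in a compact set avoiding 0, on
  which inversion is continuous.\<close>

lemma relcompact_inverse_not_in_nhd:
  fixes U :: "'a::local_field set"
  assumes U: "open U" "0 \<in> U"
  shows "relcompact {z. inverse z \<notin> U}"
proof -
  obtain t :: 'a and K U1 where t: "t \<noteq> 0" and K: "compact K"
    and U1: "open U1" "0 \<in> U1" "U1 \<subseteq> K" and tK: "\<And>x. x \<in> K \<Longrightarrow> t * x \<in> K"
    and contract: "\<And>U. open U \<Longrightarrow> 0 \<in> U \<Longrightarrow> \<exists>n. \<forall>x\<in>K. t ^ n * x \<in> U"
    using ex_contraction[where 'a='a] by auto
  obtain k where k: "k \<in> U1" "k \<noteq> 0" using nonzero_in_nhd_zero[OF U1(1,2)] by blast
  obtain m where m: "\<forall>x\<in>K. t ^ m * x \<in> U" using contract[OF U] by blast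
  \<comment> \<open>A compact shell, \<open>K\<close> without \<open>t U1\<close>. It contains the
    first point in \<open>K\<close> of any orbit of \<open>t\<close> that starts outside
    \<open>K\<close>.\<close>
  define A where "A = K - (\<lambda>x. inverse t * x) -` U1"
  have "compact A" unfolding A_def
    by (intro compact_diff K open_vimage U1(1)) (auto intro!: continuous_intros)
  moreover have "0 \<notin> A" using U1(2) by (simp add: A_def)
  ultimately have "compact (inverse ` A)" by (rule compact_inverse_image)
  then have D: "compact ((*) (inverse k * inverse (t ^ m)) ` ((\<lambda>(x, y). x * y) ` (K \<times> inverse ` A)))"
    by (intro compact_scale compact_times_image K)
  have tk: "t ^ n * k \<in> K" for n
  proof (induction n)
    case 0 then show ?case using k U1 by auto
  next
    case (Suc n) then show ?case using tK[OF Suc] by (simp add: mult.assoc)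
  qed
  show ?thesis
  proof (rule relcompactI[OF D], rule subsetI)
    fix z assume "z \<in> {z. inverse z \<notin> U}"
    then have zU: "inverse z \<notin> U" by simp
    then have z0: "z \<noteq> 0" using U by auto
    define y where "y = inverse (t ^ m) * inverse z"
    have y: "y \<notin> K"
    proof
      assume "y \<in> K"
      with m have "t ^ m * y \<in> U" by blast
      with zU t show False by (simp add: y_def mult.assoc[symmetric])
    qed
    \<comment> \<open>The contraction is uniform on \<open>K\<close>, which does not contain
      \<open>y\<close>; so it is applied to \<open>k\<close>, with the target rescaled by
      \<open>y / k\<close>.\<close>
    have "open ((\<lambda>x. x * (y * inverse k)) -` U1)"
      by (intro open_vimage U1(1)) (auto intro!: continuous_intros)
    then obtain n where "\<forall>x\<in>K. t ^ n * x \<in> (\<lambda>x. x * (y * inverse k)) -` U1"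
      using contract[of "(\<lambda>x. x * (y * inverse k)) -` U1"] U1(2) by auto
    then have "t ^ n * k * (y * inverse k) \<in> U1" using k U1 by blast
    then have "t ^ n * y \<in> K" using k U1(3) by (auto simp: field_simps)
    then have least: "t ^ (LEAST n. t ^ n * y \<in> K) * y \<in> K" (is "t ^ ?l * y \<in> K")
      by (rule LeastI)
    define w where "w = t ^ ?l * y"
    have "?l \<noteq> 0" using least y by (metis power_0 mult_1)
    then obtain l where l: "?l = Suc l" using not0_implies_Suc by blast
    then have "t ^ l * y \<notin> K" using not_less_Least[of l "\<lambda>n. t ^ n * y \<in> K"] by simp
    moreover have "inverse t * w = t ^ l * y" using t by (simp add: w_def l)
    ultimately have "inverse t * w \<notin> U1" using U1(3) by auto
    moreover have "w \<in> K" using least by (simp add: w_def)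
    ultimately have "w \<in> A" by (simp add: A_def)
    \<comment> \<open>The exponent \<open>?l\<close> depends on \<open>z\<close>, but
      \<open>t^?l k\<close> stays in \<open>K\<close> for every exponent; the factor
      \<open>k\<close> is inserted for this purpose.\<close>
    moreover have "z = inverse k * inverse (t ^ m) * ((t ^ ?l * k) * inverse w)"
      using t k z0 by (simp add: w_def y_def field_simps)
    ultimately show "z \<in> (*) (inverse k * inverse (t ^ m)) ` ((\<lambda>(x, y). x * y) ` (K \<times> inverse ` A))"
      using tk[of ?l] by blast
  qed
qed

text \<open>If \<open>1 / z\<close> is small, then \<open>(1 / z)^k\<close> times an element of
  \<open>C\<close> cannot be 1, so \<open>z^k\<close> is not in \<open>C\<close>. This bounds roots
  of bounded quantities.\<close>

lemma relcompact_power_preimage: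
  fixes C :: "'a::local_field set"
  assumes C: "compact C" and "k \<ge> 1"
  shows "relcompact {z. z ^ k \<in> C}"
proof -
  obtain W :: "'a set" where W: "open W" "0 \<in> W" "\<And>w c. w \<in> W \<Longrightarrow> c \<in> C \<Longrightarrow> w * c \<in> - {1}"
    using nhd_zero_times_compact[OF C, of "- {1}"] by auto
  have "open ((\<lambda>u. u ^ k) -` W)"
    by (intro open_vimage W(1)) (auto intro!: continuous_intros)
  moreover have "0 \<in> (\<lambda>u. u ^ k) -` W" using W(2) \<open>k \<ge> 1\<close> by (cases k) auto
  ultimately have "relcompact {z. inverse z \<notin> (\<lambda>u. u ^ k) -` W}"
    by (rule relcompact_inverse_not_in_nhd)
  \<comment> \<open>Since \<open>inverse 0 = 0\<close>, the point 0 is not in the second set and is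
    added by hand.\<close>
  then have "relcompact ({0} \<union> {z. inverse z \<notin> (\<lambda>u. u ^ k) -` W})"
    by (intro relcompact_Un[OF relcompact_finite]) simp_all
  then show ?thesis
  proof (rule relcompact_subset, intro subsetI)
    fix z assume z: "z \<in> {z. z ^ k \<in> C}"
    show "z \<in> {0} \<union> {z. inverse z \<notin> (\<lambda>u. u ^ k) -` W}"
    proof (rule ccontr)
      assume "\<not> ?thesis"
      then have "z \<noteq> 0" "inverse z ^ k \<in> W" by auto
      with W(3)[of "inverse z ^ k" "z ^ k"] z show False
        by (simp add: power_inverse)
    qed
  qed
qed

text \<open>Compact counterpart of the dichotomy that \<open>z\<close> or \<open>1 / z\<close> has
  absolute value at most 1; applied to ratios, it compares two field elements.\<close>

lemma obtain_compact_or_inverse: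
  obtains C :: "'a::local_field set" where "compact C" "\<And>z. z \<in> C \<or> inverse z \<in> C"
proof -
  obtain U0 K :: "'a set" where K: "open U0" "compact K" "0 \<in> U0" "U0 \<subseteq> K"
    using locally_compact by blast
  obtain C where C: "compact C" "{z. inverse z \<notin> U0} \<subseteq> C"
    using relcompact_inverse_not_in_nhd[OF K(1,3)] unfolding relcompact_def by blast
  show ?thesis
    by (rule that[of "K \<union> C"]) (use C K in auto)
qed

text \<open>A substitute for choosing the entry of largest absolute value.\<close>

lemma compact_pivot:
  assumes "finite I" "I \<noteq> {}"
  shows "\<exists>D :: 'a::local_field set. compact D \<and>
           (\<forall>z. \<exists>k\<in>I. \<forall>l\<in>I. \<exists>d\<in>D. z l = z k * d)"
  using assms
proof (induction I rule: finite_ne_induct)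
  case (singleton a)
  show ?case by (intro exI[of _ "{1}"]) auto
next
  case (insert a I)
  then obtain D :: "'a set" where D: "compact D" "\<And>z. \<exists>k\<in>I. \<forall>l\<in>I. \<exists>d\<in>D. z l = z k * d"
    by blast
  obtain C :: "'a set" where C: "compact C" "\<And>z. z \<in> C \<or> inverse z \<in> C"
    using obtain_compact_or_inverse by blast
  have 0: "0 \<in> C" using C(2)[of 0] by simp
  \<comment> \<open>Either the old pivot survives and the entry at \<open>a\<close> has ratio in
    \<open>C\<close> to it, or \<open>a\<close> becomes the pivot and every old ratio in
    \<open>D\<close> acquires a factor from \<open>C\<close>. The 1 is the ratio of the new pivot to
    itself.\<close>
  define E where "E = insert 1 (D \<union> C \<union> (\<lambda>(x, y). x * y) ` (C \<times> D))"
  have "compact E" unfolding E_def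
    by (intro compact_insert compact_Un compact_times_image C D)
  moreover have "\<exists>k\<in>insert a I. \<forall>l\<in>insert a I. \<exists>d\<in>E. z l = z k * d" for z
  proof -
    obtain k where k: "k \<in> I" "\<And>l. l \<in> I \<Longrightarrow> \<exists>d\<in>D. z l = z k * d" using D(2)[of z] by blast
    have "(\<exists>c\<in>C. z a = z k * c) \<or> (\<exists>c\<in>C. z k = z a * c)"
    proof (cases "z k = 0 \<or> z a = 0")
      case True
      then show ?thesis using 0 by (metis mult_zero_right)
    next
      case False
      then have "z a = z k * (z a / z k)" "z k = z a * inverse (z a / z k)"
        by (auto simp: field_simps)
      then show ?thesis using C(2)[of "z a / z k"] by blast
    qed
    then show ?thesis
    proof
      assume "\<exists>c\<in>C. z a = z k * c"
      with k show ?thesis unfolding E_def by (intro bexI[of _ k]) auto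
    next
      assume "\<exists>c\<in>C. z k = z a * c"
      then obtain c where c: "c \<in> C" "z k = z a * c" by blast
      have "\<exists>d\<in>E. z l = z a * d" if "l \<in> I" for l
      proof -
        from k(2) that obtain d where "d \<in> D" "z l = z k * d" by blast
        then show ?thesis using c unfolding E_def by (intro bexI[of _ "c * d"]) (auto simp: mult.assoc)
      qed
      moreover have "z a = z a * 1" "1 \<in> E" by (auto simp: E_def)
      ultimately show ?thesis by (intro bexI[of _ a]) blast+
    qed
  qed
  ultimately show ?case by blast
qed

section \<open>Infinite subfields of a local field\<close>

lemma subfield_type_algebra:
  fixes H :: "'a::field set"
  assumes "subfield H ring_of_type_algebra"
  shows "0 \<in> H" "1 \<in> H" "\<And>x y. x \<in> H \<Longrightarrow> y \<in> H \<Longrightarrow> x + y \<in> H"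
    "\<And>x. x \<in> H \<Longrightarrow> - x \<in> H" "\<And>x y. x \<in> H \<Longrightarrow> y \<in> H \<Longrightarrow> x * y \<in> H"
    "\<And>x. x \<in> H \<Longrightarrow> inverse x \<in> H"
proof -
  let ?R = "ring_of_type_algebra :: 'a ring"
  interpret subfield H ?R by fact
  have ops: "\<zero>\<^bsub>?R\<^esub> = 0" "\<one>\<^bsub>?R\<^esub> = 1" "x \<oplus>\<^bsub>?R\<^esub> y = x + y" "x \<otimes>\<^bsub>?R\<^esub> y = x * y" for x y
    by (simp_all add: ring_of_type_algebra_def)
  show 0: "0 \<in> H" and "1 \<in> H" and "\<And>x y. x \<in> H \<Longrightarrow> y \<in> H \<Longrightarrow> x + y \<in> H"
    and "\<And>x y. x \<in> H \<Longrightarrow> y \<in> H \<Longrightarrow> x * y \<in> H"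
    using one_closed m_closed subgroup.one_closed[OF subgroup_axioms] subgroup.m_closed[OF subgroup_axioms]
    by (auto simp: ops ring_of_type_algebra_def)
  show "- x \<in> H" if "x \<in> H" for x
  proof -
    interpret ring ?R by (rule ring_from_type_algebra)
    have "\<ominus>\<^bsub>?R\<^esub> x \<in> H"
      using subgroup.m_inv_closed[OF subgroup_axioms that] by (simp add: a_inv_def)
    moreover have "\<ominus>\<^bsub>?R\<^esub> x = - x"
      using l_neg[of x] by (simp add: ring_of_type_algebra_def eq_neg_iff_add_eq_0)
    ultimately show ?thesis by simp
  qed
  show "inverse x \<in> H" if "x \<in> H" for x
  proof (cases "x = 0")
    case True with 0 show ?thesis by simp
  next
    case False
    with that have "x \<in> Units (?R \<lparr>carrier := H\<rparr>)" by (simp add: subfield_Units ops)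
    then obtain y where "y \<in> H" "x * y = 1" by (auto simp: Units_def ops)
    then show ?thesis by (metis inverse_unique)
  qed
qed

text \<open>A relatively compact infinite \<open>H\<close> has a limit point, and differences of
  elements close to it are small. Otherwise \<open>H\<close> has elements so large that their
  inverses lie in \<open>U\<close>.\<close>

lemma subfield_accumulates_at_zero:
  fixes H :: "'a::local_field set"
  assumes H: "subfield H ring_of_type_algebra" and inf: "infinite H" and U: "open U" "0 \<in> U"
  obtains h where "h \<in> H" "h \<in> U" "h \<noteq> 0"
proof (cases "relcompact H")
  case True
  then obtain C where C: "compact C" "H \<subseteq> C" unfolding relcompact_def by blast
  obtain x where x: "x islimpt H"
    using Heine_Borel_imp_Bolzano_Weierstrass[OF C(1) inf C(2)] by blast
  have "open ((\<lambda>p. fst p - snd p) -` U)"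
    by (intro open_vimage U(1)) (auto intro!: continuous_intros)
  moreover have "(x, x) \<in> (\<lambda>p. fst p - snd p) -` U" using U by simp
  ultimately obtain A B where AB: "open A" "open B" "x \<in> A" "x \<in> B"
    "A \<times> B \<subseteq> (\<lambda>p. fst p - snd p) -` U"
    by (rule open_prod_elim[of _ "(x, x)"]) auto
  obtain a where a: "a \<in> H" "a \<in> A" "a \<noteq> x" using islimptE[OF x AB(3,1)] by metis
  \<comment> \<open>Removing \<open>a\<close> leaves a neighbourhood of \<open>x\<close>, because
    \<open>a\<close> differs from \<open>x\<close>; it ensures
    \<open>a - b \<noteq> 0\<close>.\<close>
  have "open (B - {a})" "x \<in> B - {a}" using AB a by (auto simp: open_delete)
  then obtain b where b: "b \<in> H" "b \<in> B - {a}"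
    using islimptE[OF x \<open>x \<in> B - {a}\<close> \<open>open (B - {a})\<close>] by metis
  show ?thesis
  proof (rule that[of "a - b"])
    show "a - b \<in> H"
      using subfield_type_algebra(3,4)[OF H] a b by (metis diff_conv_add_uminus)
    show "a - b \<in> U" using AB a b by auto
    show "a - b \<noteq> 0" using b by auto
  qed
next
  case False
  have "relcompact ({0} \<union> {z. inverse z \<notin> U})"
    by (rule relcompact_Un[OF relcompact_finite relcompact_inverse_not_in_nhd[OF U]]) simp
  with False obtain h where "h \<in> H" "h \<notin> {0} \<union> {z. inverse z \<notin> U}"
    using relcompact_subset by blast
  then show ?thesis
    using that[of "inverse h"] subfield_type_algebra(6)[OF H] by auto
qed

text \<open>The inverse of a nonzero element of \<open>H\<close> close enough to 0 escapes any given
  compact set.\<close>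

lemma not_relcompact_subfield:
  fixes H :: "'a::local_field set"
  assumes H: "subfield H ring_of_type_algebra" "infinite H"
  shows "\<not> relcompact H"
proof
  assume "relcompact H"
  then obtain C where C: "compact C" "H \<subseteq> C" unfolding relcompact_def by blast
  obtain W :: "'a set" where W: "open W" "0 \<in> W" "\<And>w c. w \<in> W \<Longrightarrow> c \<in> C \<Longrightarrow> w * c \<in> - {1}"
    using nhd_zero_times_compact[OF C(1), of "- {1}"] by auto
  obtain h where h: "h \<in> H" "h \<in> W" "h \<noteq> 0"
    using subfield_accumulates_at_zero[OF H W(1,2)] by blast
  then have "inverse h \<in> C" using subfield_type_algebra(6)[OF H(1)] C by blast
  from W(3)[OF h(2) this] h(3) show False by simp
qed

section \<open>Matrices over a topological field\<close>

lemma continuous_on_vec_nth: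
  fixes f :: "'b::topological_space \<Rightarrow> 'a::topological_space^'n"
  shows "continuous_on S f \<Longrightarrow> continuous_on S (\<lambda>x. f x $ i)"
  by (auto simp: continuous_on_def intro: tendsto_vec_nth)

lemma continuous_on_vecI:
  fixes f :: "'b::topological_space \<Rightarrow> 'a::topological_space^'n"
  shows "(\<And>i. continuous_on S (\<lambda>x. f x $ i)) \<Longrightarrow> continuous_on S f"
  by (auto simp: continuous_on_def intro: vec_tendstoI)

lemma open_vimage_vec_nth: "open A \<Longrightarrow> open ((\<lambda>z :: 'a::topological_space^'n. z $ i) -` A)"
  by (intro open_vimage continuous_on_vec_nth continuous_on_id)

instance vec :: (t0_space, finite) t0_space
proof
  fix x y :: "'a^'b"
  assume "x \<noteq> y"
  then obtain i where neq: "x $ i \<noteq> y $ i" by (auto simp: vec_eq_iff)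
  then obtain U where "open U" "\<not> (x $ i \<in> U \<longleftrightarrow> y $ i \<in> U)"
    using t0_space_class.t0_space[OF neq] by blast
  then show "\<exists>U. open U \<and> \<not> (x \<in> U \<longleftrightarrow> y \<in> U)"
    by (intro exI[of _ "(\<lambda>z. z $ i) -` U"]) (auto intro: open_vimage_vec_nth)
qed

instance vec :: (t1_space, finite) t1_space
proof
  fix x y :: "'a^'b"
  assume "x \<noteq> y"
  then obtain i where neq: "x $ i \<noteq> y $ i" by (auto simp: vec_eq_iff)
  then obtain U where "open U" "x $ i \<in> U" "y $ i \<notin> U"
    using t1_space_class.t1_space[OF neq] by blast
  then show "\<exists>U. open U \<and> x \<in> U \<and> y \<notin> U"
    by (intro exI[of _ "(\<lambda>z. z $ i) -` U"]) (auto intro: open_vimage_vec_nth)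
qed

instance vec :: (t2_space, finite) t2_space
proof
  fix x y :: "'a^'b"
  assume "x \<noteq> y"
  then obtain i where neq: "x $ i \<noteq> y $ i" by (auto simp: vec_eq_iff)
  then obtain U V where "open U" "open V" "x $ i \<in> U" "y $ i \<in> V" "U \<inter> V = {}"
    using hausdorff[OF neq] by blast
  then show "\<exists>U V. open U \<and> open V \<and> x \<in> U \<and> y \<in> V \<and> U \<inter> V = {}"
    by (intro exI[of _ "(\<lambda>z. z $ i) -` U"] exI[of _ "(\<lambda>z. z $ i) -` V"])
      (auto intro: open_vimage_vec_nth)
qed

lemma continuous_on_det:
  fixes f :: "'b::topological_space \<Rightarrow> 'a::topological_field^'n^'n"
  assumes "continuous_on S f"
  shows "continuous_on S (\<lambda>x. det (f x))"
  unfolding det_def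
  by (intro continuous_intros continuous_on_vec_nth assms)

lemma continuous_on_matrix_mult:
  fixes f g :: "'b::topological_space \<Rightarrow> 'a::topological_field^'n^'n"
  assumes "continuous_on S f" "continuous_on S g"
  shows "continuous_on S (\<lambda>x. f x ** g x)"
  unfolding matrix_matrix_mult_def
  by (intro continuous_on_vecI) (auto intro!: continuous_intros continuous_on_vec_nth assms)

text \<open>Tychonoff for functions on pairs of indices, transported by the continuous map that
  reads such a function as a matrix.\<close>

lemma compact_matrices:
  fixes C :: "'a::topological_space set"
  assumes "compact C"
  shows "compact {M :: 'a^'n^'m. \<forall>i j. M $ i $ j \<in> C}"
proof -
  have "compactin (product_topology (\<lambda>i. euclidean) UNIV) (PiE (UNIV :: ('m \<times> 'n) set) (\<lambda>i. C))"
    using assms by (simp add: compactin_PiE)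
  then have "compact (PiE (UNIV :: ('m \<times> 'n) set) (\<lambda>i. C))"
    by (simp add: euclidean_product_topology)
  moreover have "continuous_on UNIV (\<lambda>f :: 'm \<times> 'n \<Rightarrow> 'a. (\<chi> i j. f (i, j)) :: 'a^'n^'m)"
    by (intro continuous_on_vecI) (auto intro: continuous_on_product_coordinates)
  ultimately have "compact ((\<lambda>f. (\<chi> i j. f (i, j)) :: 'a^'n^'m) ` PiE UNIV (\<lambda>i. C))"
    by (intro compact_continuous_image) (auto intro: continuous_on_subset)
  moreover have "{M :: 'a^'n^'m. \<forall>i j. M $ i $ j \<in> C} = (\<lambda>f. (\<chi> i j. f (i, j)) :: 'a^'n^'m) ` PiE UNIV (\<lambda>i. C)"
  proof (intro equalityI subsetI)
    fix M :: "'a^'n^'m"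
    assume "M \<in> {M. \<forall>i j. M $ i $ j \<in> C}"
    then show "M \<in> (\<lambda>f. (\<chi> i j. f (i, j)) :: 'a^'n^'m) ` PiE UNIV (\<lambda>i. C)"
      by (intro image_eqI[of _ _ "\<lambda>(i, j). M $ i $ j"]) (auto simp: vec_eq_iff)
  qed auto
  ultimately show ?thesis by simp
qed

text \<open>The numerators of Cramer's rule: column \<open>k\<close> of \<open>A\<close> is replaced
  by the unit vector \<open>j\<close>. In determinant 1 this is the inverse, but polynomial in the
  entries, so continuity and entries in \<open>H\<close> come without any division.\<close>

definition adjugate :: "'a::comm_ring_1^'n^'n \<Rightarrow> 'a^'n^'n" where
  "adjugate A = (\<chi> k j. det (\<chi> i l. if l = k then (if i = j then 1 else 0) else A $ i $ l))"

lemma adjugate_right_inverse: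
  fixes A :: "'a::field^'n^'n"
  assumes "det A = 1"
  shows "A ** adjugate A = mat 1"
proof -
  have "A *v (\<chi> k. adjugate A $ k $ j) = (\<chi> i. if i = j then 1 else 0)" for j
    using cramer[of A "\<chi> k. adjugate A $ k $ j" "\<chi> i. if i = j then 1 else 0"] assms
    by (simp add: adjugate_def cong: if_cong)
  then have "(\<Sum>k\<in>UNIV. A $ i $ k * adjugate A $ k $ j) = (if i = j then 1 else 0)" for i j
    by (simp add: matrix_vector_mult_def vec_eq_iff)
  then show ?thesis
    by (simp add: matrix_matrix_mult_def mat_def vec_eq_iff)
qed

lemma adjugate_left_inverse:
  fixes A :: "'a::field^'n^'n"
  shows "det A = 1 \<Longrightarrow> adjugate A ** A = mat 1"
  by (rule matrix_left_right_inverse1) (rule adjugate_right_inverse)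

lemma continuous_on_adjugate:
  fixes f :: "'b::topological_space \<Rightarrow> 'a::topological_field^'n^'n"
  assumes "continuous_on S f"
  shows "continuous_on S (\<lambda>x. adjugate (f x))"
proof -
  have "continuous_on S (\<lambda>x. if l = k then if i = j then 1 else 0 else f x $ i $ l)" for i j k l
    by (cases "l = k") (auto intro!: continuous_on_vec_nth assms)
  then show ?thesis
    unfolding adjugate_def
    by (intro continuous_on_vecI) (auto intro!: continuous_on_det continuous_on_vecI)
qed

section \<open>Transvections\<close>

definition transvection :: "'n \<Rightarrow> 'n \<Rightarrow> 'a::comm_ring_1 \<Rightarrow> 'a^'n^'n" where
  "transvection i j t = (\<chi> p q. (if p = q then 1 else 0) + (if p = i \<and> q = j then t else 0))"

lemma transvection_nth:
  "transvection i j t $ p $ q = (if p = q then 1 else 0) + (if p = i \<and> q = j then t else 0)"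
  by (simp add: transvection_def)

lemma transvection_mult_nth:
  "(transvection i j t ** A) $ p $ q = A $ p $ q + (if p = i then t * A $ j $ q else 0)"
  by (simp add: matrix_matrix_mult_def transvection_def distrib_right sum.distrib
      if_distrib[of "\<lambda>x. x * _"] sum.delta' cong: if_cong)

lemma mult_transvection_nth:
  "(A ** transvection i j t) $ p $ q = A $ p $ q + (if q = j then A $ p $ i * t else 0)"
  by (simp add: matrix_matrix_mult_def transvection_def distrib_left sum.distrib
      if_distrib[of "\<lambda>x. _ * x"] sum.delta' cong: if_cong)

lemma transvection_add:
  "i \<noteq> j \<Longrightarrow> transvection i j s ** transvection i j t = transvection i j (s + t)"
  by (simp add: vec_eq_iff transvection_mult_nth) (auto simp: transvection_nth)

lemma transvection_0: "transvection i j 0 = mat 1"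
  by (simp add: vec_eq_iff transvection_nth mat_def)

lemma transvection_inverse:
  "i \<noteq> j \<Longrightarrow> transvection i j t ** transvection i j (- t) = mat 1"
  by (simp add: transvection_add transvection_0)

lemma det_transvection:
  fixes t :: "'a::comm_ring_1"
  assumes "i \<noteq> j"
  shows "det (transvection i j t :: 'a^'n^'n) = 1"
proof -
  have "transvection i j t = (\<chi> k. if k = i then row i (mat 1 :: 'a^'n^'n) + t *s row j (mat 1) else row k (mat 1))"
    using assms by (auto simp: vec_eq_iff transvection_nth row_def mat_def)
  then show ?thesis
    using det_row_operation[OF assms, of "mat 1 :: 'a^'n^'n" t] by simp
qed

locale special_linear =
  fixes H :: "'a::field set" and G :: "('a^'n^'n) monoid"
  assumes subfield: "subfield H ring_of_type_algebra"
    and G_def: "G = SL H"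
begin

lemmas H_closed = subfield_type_algebra[OF subfield]

lemma H_diff: "x \<in> H \<Longrightarrow> y \<in> H \<Longrightarrow> x - y \<in> H"
  using H_closed(3,4) by (metis diff_conv_add_uminus)

lemma H_divide: "x \<in> H \<Longrightarrow> y \<in> H \<Longrightarrow> x / y \<in> H"
  using H_closed(5,6) by (simp add: divide_inverse)

lemma H_sum: "(\<And>i. i \<in> I \<Longrightarrow> f i \<in> H) \<Longrightarrow> sum f I \<in> H"
  by (induction I rule: infinite_finite_induct) (auto simp: H_closed)

lemma H_prod: "(\<And>i. i \<in> I \<Longrightarrow> f i \<in> H) \<Longrightarrow> prod f I \<in> H"
  by (induction I rule: infinite_finite_induct) (auto simp: H_closed)

lemma H_det:
  fixes A :: "'a^'n^'n"
  assumes "\<And>i j. A $ i $ j \<in> H"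
  shows "det A \<in> H"
proof -
  have "of_int (sign p) \<in> H" for p :: "'n \<Rightarrow> 'n"
    by (auto simp: H_closed sign_def)
  then show ?thesis
    unfolding det_def by (intro H_sum H_closed(5) H_prod assms)
qed

lemma G_carrier: "A \<in> carrier G \<longleftrightarrow> (\<forall>i j. A $ i $ j \<in> H) \<and> det A = 1"
  by (simp add: G_def SL_def)

lemma G_mult: "x \<otimes>\<^bsub>G\<^esub> y = x ** y" and G_one: "\<one>\<^bsub>G\<^esub> = mat 1"
  by (simp_all add: G_def SL_def)

lemma H_mult:
  fixes A B :: "'a^'n^'n"
  shows "(\<And>i j. A $ i $ j \<in> H) \<Longrightarrow> (\<And>i j. B $ i $ j \<in> H) \<Longrightarrow> (A ** B) $ i $ j \<in> H"
  by (auto simp: matrix_matrix_mult_def intro!: H_sum H_closed)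

lemma mult_in_G: "x \<in> carrier G \<Longrightarrow> y \<in> carrier G \<Longrightarrow> x ** y \<in> carrier G"
  by (simp add: G_carrier det_mul H_mult)

lemma adjugate_in_G:
  assumes "x \<in> carrier G"
  shows "adjugate x \<in> carrier G"
proof -
  have "det x * det (adjugate x) = 1"
    using arg_cong[OF adjugate_right_inverse[of x], of det] assms by (simp add: G_carrier det_mul)
  then show ?thesis
    using assms by (auto simp: G_carrier adjugate_def H_closed intro!: H_det)
qed

lemma mat_1_in_G: "mat 1 \<in> carrier G"
  by (auto simp: G_carrier mat_def[of 1] H_closed) (simp flip: mat_def)

lemma group_G: "group G"
proof (rule groupI)
  show "\<exists>y\<in>carrier G. y \<otimes>\<^bsub>G\<^esub> x = \<one>\<^bsub>G\<^esub>" if "x \<in> carrier G" for x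
    using that adjugate_in_G adjugate_left_inverse[of x] by (auto simp: G_carrier G_mult G_one)
qed (auto simp: G_mult G_one mult_in_G mat_1_in_G matrix_mul_assoc)

sublocale group G by (rule group_G)

lemma G_inv:
  assumes "x \<in> carrier G"
  shows "inv\<^bsub>G\<^esub> x = adjugate x"
  by (rule inv_equality)
    (use assms adjugate_in_G adjugate_left_inverse[of x] in \<open>auto simp: G_mult G_one G_carrier\<close>)

lemma transvection_in_G: "i \<noteq> j \<Longrightarrow> t \<in> H \<Longrightarrow> transvection i j t \<in> carrier G"
  by (auto simp: G_carrier det_transvection transvection_nth H_closed)

end

section \<open>Generation of the special linear group by transvections\<close>

locale transvection_group = special_linear H G
  for H :: "'a::field set" and G :: "('a^'n^'n) monoid" +
  fixes N :: "('a^'n^'n) set"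
  assumes N_mult: "x \<in> N \<Longrightarrow> y \<in> N \<Longrightarrow> x ** y \<in> N"
    and transvection_in_N: "i \<noteq> j \<Longrightarrow> t \<in> H \<Longrightarrow> transvection i j t \<in> N"
    and N_subset: "N \<subseteq> carrier G"
    and mat_1_in_N: "mat 1 \<in> N"
begin

definition column_transvection :: "'n set \<Rightarrow> 'n \<Rightarrow> ('n \<Rightarrow> 'a) \<Rightarrow> 'a^'n^'n" where
  "column_transvection T k c = (\<chi> p q. (if p = q then 1 else 0) + (if q = k \<and> p \<in> T then c p else 0))"

definition row_transvection :: "'n set \<Rightarrow> 'n \<Rightarrow> ('n \<Rightarrow> 'a) \<Rightarrow> 'a^'n^'n" where
  "row_transvection T k c = (\<chi> p q. (if p = q then 1 else 0) + (if p = k \<and> q \<in> T then c q else 0))"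

lemma column_transvection_mult_nth:
  "(column_transvection T k c ** A) $ p $ q = A $ p $ q + (if p \<in> T then c p * A $ k $ q else 0)"
  by (simp add: matrix_matrix_mult_def column_transvection_def distrib_right sum.distrib
      if_distrib[of "\<lambda>x. x * _"] sum.delta' cong: if_cong)

lemma mult_row_transvection_nth:
  "(A ** row_transvection T k c) $ p $ q = A $ p $ q + (if q \<in> T then A $ p $ k * c q else 0)"
  by (simp add: matrix_matrix_mult_def row_transvection_def distrib_left sum.distrib
      if_distrib[of "\<lambda>x. _ * x"] sum.delta' cong: if_cong)

lemma column_transvection_in_N:
  assumes "finite T" "k \<notin> T" "\<And>p. c p \<in> H"
  shows "column_transvection T k c \<in> N"
  using assms(1,2)
proof (induction T rule: finite_induct)
  case empty
  have "column_transvection {} k c = mat 1"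
    by (simp add: column_transvection_def mat_def)
  then show ?case using mat_1_in_N by simp
next
  case (insert a T)
  have "column_transvection (insert a T) k c = transvection a k (c a) ** column_transvection T k c"
    using insert by (auto simp: vec_eq_iff transvection_mult_nth column_transvection_def)
  then show ?case using insert by (auto intro!: N_mult transvection_in_N assms)
qed

lemma row_transvection_in_N:
  assumes "finite T" "k \<notin> T" "\<And>p. c p \<in> H"
  shows "row_transvection T k c \<in> N"
  using assms(1,2)
proof (induction T rule: finite_induct)
  case empty
  have "row_transvection {} k c = mat 1"
    by (simp add: row_transvection_def mat_def)
  then show ?case using mat_1_in_N by simp
next
  case (insert a T)
  have "row_transvection (insert a T) k c = row_transvection T k c ** transvection k a (c a)"
    using insert by (auto simp: vec_eq_iff mult_transvection_nth row_transvection_def)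
  then show ?case using insert by (auto intro!: N_mult transvection_in_N assms)
qed

text \<open>The elimination is an induction on the set \<open>S\<close> of indices still to be
  treated; this avoids cutting matrices over an unordered index type into blocks.\<close>

definition identity_outside :: "'n set \<Rightarrow> 'a^'n^'n \<Rightarrow> bool" where
  "identity_outside S A \<longleftrightarrow> (\<forall>p q. p \<notin> S \<or> q \<notin> S \<longrightarrow> A $ p $ q = (if p = q then 1 else 0))"

lemma identity_outsideD:
  "identity_outside S A \<Longrightarrow> p \<notin> S \<or> q \<notin> S \<Longrightarrow> A $ p $ q = (if p = q then 1 else 0)"
  by (auto simp: identity_outside_def)

text \<open>With pivot 1, column \<open>k\<close> is cleared by \<open>C'\<close> on the left and
  row \<open>k\<close> by \<open>R'\<close> on the right. Both operations are undone by
  \<open>C\<close> and \<open>R\<close>, which are in \<open>N\<close>, so membership of the reduced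
  matrix carries over to \<open>A\<close>.\<close>

lemma clear_row_and_column:
  assumes IH: "\<And>B. B \<in> carrier G \<Longrightarrow> identity_outside S B \<Longrightarrow> B \<in> N"
    and k: "k \<notin> S" and A: "A \<in> carrier G" "identity_outside (insert k S) A" "A $ k $ k = 1"
  shows "A \<in> N"
proof -
  define C C' where "C = column_transvection S k (\<lambda>p. A $ p $ k)"
    and "C' = column_transvection S k (\<lambda>p. - A $ p $ k)"
  define R R' where "R = row_transvection S k (\<lambda>q. A $ k $ q)"
    and "R' = row_transvection S k (\<lambda>q. - A $ k $ q)"
  have AH: "A $ p $ q \<in> H" for p q using A by (simp add: G_carrier)
  have N: "C \<in> N" "C' \<in> N" "R \<in> N" "R' \<in> N"
    unfolding C_def C'_def R_def R'_def
    using k AH by (auto intro!: column_transvection_in_N row_transvection_in_N H_closed(4))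
  have CC: "C ** C' = mat 1"
    unfolding C_def vec_eq_iff column_transvection_mult_nth using k
    by (auto simp: C'_def column_transvection_def mat_def)
  have RR: "R' ** R = mat 1"
    unfolding R_def vec_eq_iff mult_row_transvection_nth using k
    by (auto simp: R'_def row_transvection_def mat_def)
  have "identity_outside S (C' ** A ** R')"
    unfolding identity_outside_def R'_def C'_def mult_row_transvection_nth column_transvection_mult_nth
  proof (intro allI impI, goal_cases)
    case (1 p q)
    note out = identity_outsideD[OF A(2)]
    consider "p = k" | "q = k" | "p \<noteq> k" "q \<noteq> k" "p \<notin> S" | "p \<noteq> k" "q \<noteq> k" "q \<notin> S" using 1 by blast
    then show ?case
    proof cases
      case 1 then show ?thesis using k A(3) out[of k q] by auto
    next
      case 2 then show ?thesis using k A(3) out[of p k] by auto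
    next
      case 3 then show ?thesis using k out[of p q] out[of p k] by auto
    next
      case 4 then show ?thesis using k out[of p q] out[of k q] by auto
    qed
  qed
  moreover have "C' ** A ** R' \<in> carrier G"
    using N N_subset A by (auto intro!: mult_in_G)
  ultimately have "C ** (C' ** A ** R') ** R \<in> N"
    using N_mult[OF N_mult[OF N(1) IH] N(3)] by blast
  moreover have "C ** (C' ** A ** R') ** R = (C ** C') ** A ** (R' ** R)"
    by (simp add: matrix_mul_assoc)
  ultimately show ?thesis by (simp add: CC RR)
qed

lemma in_N_if_transvection_mult:
  assumes "transvection i j t ** A \<in> N" "i \<noteq> j" "t \<in> H"
  shows "A \<in> N"
proof -
  have "transvection i j (- t) ** (transvection i j t ** A) = A"
    using assms by (simp add: matrix_mul_assoc transvection_add transvection_0)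
  then show ?thesis
    using assms N_mult[OF transvection_in_N[of i j "- t"]] H_closed(4) by metis
qed

lemma identity_outside_transvection_mult:
  assumes "identity_outside S A" "i \<in> S" "j \<in> S"
  shows "identity_outside S (transvection i j t ** A)"
  using identity_outsideD[OF assms(1)] assms(2,3)
  by (auto simp: identity_outside_def transvection_mult_nth)

lemma identity_outside_in_N:
  assumes "finite S" "A \<in> carrier G" "identity_outside S A"
  shows "A \<in> N"
  using assms
proof (induction S arbitrary: A rule: finite_induct)
  case empty
  then have "A = mat 1" by (simp add: identity_outside_def vec_eq_iff mat_def)
  then show ?case using mat_1_in_N by simp
next
  case (insert k S)
  have pivot1: "B \<in> N" if "B \<in> carrier G" "identity_outside (insert k S) B" "B $ k $ k = 1" for B
    using clear_row_and_column[OF insert.IH \<open>k \<notin> S\<close> that] .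
  have pivot: "B \<in> N"
    if B: "B \<in> carrier G" "identity_outside (insert k S) B" and i: "i \<in> S" "B $ i $ k \<noteq> 0" for B i
  proof (rule in_N_if_transvection_mult)
    \<comment> \<open>Adding \<open>?t\<close> times row \<open>i\<close> to row \<open>k\<close>
      turns the entry at \<open>(k, k)\<close> into 1.\<close>
    let ?t = "(1 - B $ k $ k) / B $ i $ k"
    show ki: "k \<noteq> i" using i insert by auto
    show t: "?t \<in> H"
      using B by (auto simp: G_carrier intro!: H_divide H_diff H_closed)
    show "transvection k i ?t ** B \<in> N"
      by (rule pivot1)
        (use B i ki t in \<open>auto simp: transvection_mult_nth intro!: mult_in_G transvection_in_G
           identity_outside_transvection_mult\<close>)
  qed
  show ?case
  proof (cases "\<exists>i\<in>S. A $ i $ k \<noteq> 0")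
    case True
    then show ?thesis using pivot insert.prems by blast
  next
    case False
    have col: "A $ p $ k = 0" if "p \<noteq> k" for p
      using False identity_outsideD[OF insert.prems(2), of p k] that by auto
    have detA: "det A = 1" using insert.prems by (simp add: G_carrier)
    show ?thesis
    proof (cases "S = {}")
      case True
      have "A $ p $ q = 0" if "p \<noteq> q" for p q
        using identity_outsideD[OF insert.prems(2), of p q] that True by auto
      then have "(\<Prod>i\<in>UNIV. A $ i $ i) = 1" using det_diagonal[of A] detA by simp
      moreover have "(\<Prod>i\<in>UNIV. A $ i $ i) = (\<Prod>i\<in>{k}. A $ i $ i)"
        by (rule prod.mono_neutral_right)
          (use identity_outsideD[OF insert.prems(2)] True in auto)
      ultimately have "A $ k $ k = 1" by simp
      then show ?thesis using pivot1 insert.prems by blast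
    next
      case False
      then obtain l where l: "l \<in> S" by blast
      have "A $ k $ k \<noteq> 0"
      proof
        assume "A $ k $ k = 0"
        with col have "column k A = 0" by (simp add: column_def vec_eq_iff) metis
        with detA show False using det_zero_column(2)[of k A] by simp
      qed
      moreover have lk: "l \<noteq> k" using l insert by auto
      \<comment> \<open>The diagonal entry is the only nonzero one in column \<open>k\<close>; it is
        copied into row \<open>l\<close> to supply the off-diagonal entry that \<open>pivot\<close>
        requires.\<close>
      ultimately have "transvection l k 1 ** A \<in> N"
        by (intro pivot[of _ l])
          (use l col insert.prems H_closed in \<open>auto simp: transvection_mult_nth intro!: mult_in_G
             transvection_in_G identity_outside_transvection_mult\<close>)
      then show ?thesis by (rule in_N_if_transvection_mult) (use lk H_closed in auto)
    qed
  qed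
qed

lemma N_eq_G: "N = carrier G"
  using identity_outside_in_N[of UNIV] N_subset by (auto simp: identity_outside_def)

end

context special_linear
begin

text \<open>Commutators with transvections carry the root group at \<open>(p, q)\<close> to those at
  \<open>(p, r)\<close> and \<open>(r, q)\<close>, and conjugation by a Weyl element carries it to
  \<open>(q, p)\<close>. For n = 2 there is no third index, and the last move does all the
  work.\<close>

lemma normal_containing_root_group:
  assumes N_mult: "\<And>x y. x \<in> N \<Longrightarrow> y \<in> N \<Longrightarrow> x ** y \<in> N"
    and N_conj: "\<And>g h x. g \<in> carrier G \<Longrightarrow> h \<in> carrier G \<Longrightarrow> g ** h = mat 1 \<Longrightarrow> x \<in> N \<Longrightarrow> g ** x ** h \<in> N"
    and "N \<subseteq> carrier G" "mat 1 \<in> N"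
    and ij: "i \<noteq> j" "\<And>t. t \<in> H \<Longrightarrow> transvection i j t \<in> N"
  shows "N = carrier G"
proof -
  define Q where "Q p q \<longleftrightarrow> p \<noteq> q \<and> (\<forall>t\<in>H. transvection p q t \<in> N)" for p q
  have conj: "transvection a b s ** x ** transvection a b (- s) \<in> N"
    if "a \<noteq> b" "s \<in> H" "x \<in> N" for a b s x
    by (rule N_conj) (use that in \<open>auto intro!: transvection_in_G H_closed transvection_inverse\<close>)
  have right: "Q p r" if Q: "Q p q" and r: "r \<noteq> p" "r \<noteq> q" for p q r
    unfolding Q_def
  proof (intro conjI ballI)
    fix t assume t: "t \<in> H"
    have "transvection p q t ** (transvection q r 1 ** transvection p q (- t) ** transvection q r (- 1)) \<in> N"
      using Q r t unfolding Q_def by (intro N_mult conj) (auto simp: H_closed)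
    moreover have "transvection p q t ** (transvection q r 1 ** transvection p q (- t) ** transvection q r (- 1)) = transvection p r t"
      using Q r unfolding vec_eq_iff transvection_mult_nth mult_transvection_nth
      by (auto simp: transvection_nth Q_def)
    ultimately show "transvection p r t \<in> N" by simp
  qed (use r in auto)
  have left: "Q r q" if Q: "Q p q" and r: "r \<noteq> p" "r \<noteq> q" for p q r
    unfolding Q_def
  proof (intro conjI ballI)
    fix t assume t: "t \<in> H"
    have "(transvection r p 1 ** transvection p q t ** transvection r p (- 1)) ** transvection p q (- t) \<in> N"
      using Q r t unfolding Q_def by (intro N_mult conj) (auto simp: H_closed)
    moreover have "(transvection r p 1 ** transvection p q t ** transvection r p (- 1)) ** transvection p q (- t) = transvection r q t"
      using Q r unfolding vec_eq_iff transvection_mult_nth mult_transvection_nth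
      by (auto simp: transvection_nth Q_def)
    ultimately show "transvection r q t \<in> N" by simp
  qed (use r in auto)
  have swap: "Q q p" if Q: "Q p q" for p q
    unfolding Q_def
  proof (intro conjI ballI)
    fix t assume t: "t \<in> H"
    have pq: "p \<noteq> q" using Q by (simp add: Q_def)
    \<comment> \<open>The transvections at \<open>(p, q)\<close>, \<open>(q, p)\<close>,
      \<open>(p, q)\<close> with parameters 1, -1, 1 multiply to a Weyl element. Conjugation by it
      moves a parameter from \<open>(p, q)\<close> to \<open>(q, p)\<close> and changes its sign,
      hence \<open>- t\<close>.\<close>
    define x where "x = transvection p q (- t)"
    have x: "x \<in> N" using Q t by (auto simp: Q_def x_def H_closed)
    let ?y = "transvection p q 1 ** (transvection q p (- 1) ** (transvection p q 1 ** x ** transvection p q (- 1))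
       ** transvection q p (- (- 1))) ** transvection p q (- 1)"
    have "?y \<in> N"
      using pq by (intro conj x) (auto simp: H_closed)
    moreover have "?y = transvection q p t"
      using pq unfolding vec_eq_iff transvection_mult_nth mult_transvection_nth x_def
      by (auto simp: transvection_nth)
    ultimately show "transvection q p t \<in> N" by simp
  qed (use Q in \<open>auto simp: Q_def\<close>)
  have Q0: "Q i j" using ij by (simp add: Q_def)
  have "Q p q" if "p \<noteq> q" for p q
    using Q0 swap[OF Q0] that right left swap by metis
  then interpret transvection_group H G N
    by unfold_locales (use assms in \<open>auto simp: Q_def\<close>)
  show ?thesis by (rule N_eq_G)
qed

end

section \<open>Coarser group topologies on the special linear group\<close>

text \<open>A dominant off-diagonal entry also controls the diagonal, because
  \<open>m ** m = 0\<close> expresses the square of a diagonal entry through products of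
  off-diagonal ones. The pivot at \<open>(j, i)\<close> has to be off-diagonal since a transvection
  at \<open>(i, j)\<close> will act on it.\<close>

lemma square_zero_pivot:
  assumes "i0 \<noteq> (j0 :: 'n::finite)"
  obtains D :: "'a::local_field set" where "compact D"
    "\<And>m :: 'a^'n^'n. m ** m = 0 \<Longrightarrow> \<exists>j i. j \<noteq> i \<and> (\<forall>p q. \<exists>d\<in>D. m $ p $ q = m $ j $ i * d)"
proof -
  define I where "I = {(p, q). p \<noteq> (q :: 'n)}"
  have "finite I" "I \<noteq> {}" using assms by (auto simp: I_def)
  then obtain D0 :: "'a set" where D0: "compact D0"
    "\<And>z. \<exists>k\<in>I. \<forall>l\<in>I. \<exists>d\<in>D0. z l = z k * d"
    using compact_pivot[OF \<open>finite I\<close> \<open>I \<noteq> {}\<close>] by auto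
  obtain d0 where d0: "d0 \<in> D0" using D0(2)[of "\<lambda>_. 0"] by (metis \<open>I \<noteq> {}\<close> ex_in_conv)
  \<comment> \<open>Contains the values that \<open>(m $ p $ p / c)^2\<close> can take,
    \<open>c\<close> being the pivot, when the ratios of the off-diagonal entries to
    \<open>c\<close> lie in \<open>D0\<close>.\<close>
  define E where "E = (\<Union>p. (\<lambda>M :: 'a^'n^'n. - (\<Sum>k\<in>UNIV-{p}. M $ p $ k * M $ k $ p)) ` {M. \<forall>i j. M $ i $ j \<in> D0})"
  have "compact E" unfolding E_def
    by (intro compact_UN compact_continuous_image compact_matrices D0 finite)
      (intro continuous_intros continuous_on_vec_nth)
  then have "relcompact {z. z ^ 2 \<in> E}"
    by (rule relcompact_power_preimage) simp
  then obtain D1 where D1: "compact D1" "{z. z ^ 2 \<in> E} \<subseteq> D1"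
    unfolding relcompact_def by blast
  show thesis
  proof (rule that)
    show "compact (D0 \<union> D1)" using D0 D1 by blast
    fix m :: "'a^'n^'n" assume m: "m ** m = 0"
    obtain k where k: "k \<in> I" "\<And>l. l \<in> I \<Longrightarrow> \<exists>d\<in>D0. m $ fst l $ snd l = m $ fst k $ snd k * d"
      using D0(2)[of "\<lambda>l. m $ fst l $ snd l"] by blast
    obtain j i where ji: "k = (j, i)" "j \<noteq> i" using k(1) by (auto simp: I_def)
    define c where "c = m $ j $ i"
    have off: "\<exists>d\<in>D0. m $ p $ q = c * d" if "p \<noteq> q" for p q
      using k(2)[of "(p, q)"] that by (simp add: I_def ji c_def)
    then have "\<forall>p q. \<exists>d\<in>D0. p \<noteq> q \<longrightarrow> m $ p $ q = c * d" using d0 by blast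
    then obtain d where d: "\<And>p q. d p q \<in> D0" "\<And>p q. p \<noteq> q \<Longrightarrow> m $ p $ q = c * d p q"
      by metis
    have diag: "\<exists>d\<in>D0 \<union> D1. m $ p $ p = c * d" for p
    proof -
      have "0 = (m ** m) $ p $ p" using m by simp
      also have "\<dots> = (\<Sum>k\<in>UNIV. m $ p $ k * m $ k $ p)" by (simp add: matrix_matrix_mult_def)
      also have "\<dots> = m $ p $ p ^ 2 + (\<Sum>k\<in>UNIV-{p}. m $ p $ k * m $ k $ p)"
        by (simp add: sum.remove[of UNIV p] power2_eq_square)
      also have "(\<Sum>k\<in>UNIV-{p}. m $ p $ k * m $ k $ p) = (\<Sum>k\<in>UNIV-{p}. c ^ 2 * (d p k * d k p))"
        by (intro sum.cong refl) (simp add: d(2) power2_eq_square)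
      also have "\<dots> = c ^ 2 * (\<Sum>k\<in>UNIV-{p}. d p k * d k p)" by (simp add: sum_distrib_left)
      finally have sq: "m $ p $ p ^ 2 = c ^ 2 * - (\<Sum>k\<in>UNIV-{p}. d p k * d k p)"
        by (simp add: eq_neg_iff_add_eq_0)
      show ?thesis
      proof (cases "c = 0")
        case True
        with sq have "m $ p $ p = 0" by simp
        with True d0 show ?thesis by auto
      next
        case False
        have "- (\<Sum>k\<in>UNIV-{p}. d p k * d k p) \<in> E"
          unfolding E_def using d(1)
          by (intro UN_I[of p] image_eqI[of _ _ "\<chi> p q. d p q"]) auto
        moreover have "(m $ p $ p / c) ^ 2 = - (\<Sum>k\<in>UNIV-{p}. d p k * d k p)"
          using sq False by (simp add: power_divide)
        ultimately have "m $ p $ p / c \<in> D1" using D1(2) by auto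
        moreover have "m $ p $ p = c * (m $ p $ p / c)" using False by simp
        ultimately show ?thesis by blast
      qed
    qed
    show "\<exists>j i. j \<noteq> i \<and> (\<forall>p q. \<exists>d\<in>D0 \<union> D1. m $ p $ q = m $ j $ i * d)"
    proof (intro exI conjI allI)
      fix p q
      show "\<exists>d\<in>D0 \<union> D1. m $ p $ q = m $ j $ i * d"
        using off[of p q] diag[of p] by (cases "p = q") (auto simp: c_def)
    qed (rule ji)
  qed
qed

text \<open>The products in the hypothesis are the entries of the conjugates by \<open>x\<close> of
  the off-diagonal matrix units. A diagonal unit is a product of two off-diagonal ones, so its
  conjugate is bounded too. Hence each entry of \<open>x\<close> times the whole inverse is bounded,
  and the determinant of that matrix is a power of the entry.\<close>

lemma bounded_if_conjugates_bounded:
  fixes E :: "'a::local_field set"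
  assumes "compact E"
  shows "\<exists>C. compact C \<and> (\<forall>x :: 'a^'n^'n. det x = 1 \<longrightarrow>
    (\<forall>p q a b. p \<noteq> q \<longrightarrow> x $ a $ p * adjugate x $ q $ b \<in> E) \<longrightarrow> (\<forall>i j. x $ i $ j \<in> C))"
proof -
  let ?M = "\<lambda>E. {M :: 'a^'n^'n. \<forall>i j. M $ i $ j \<in> E}"
  define E1 where "E1 = (\<Union>a b. (\<lambda>z. (fst z ** snd z) $ a $ b) ` (?M E \<times> ?M E))"
  have "compact E1" unfolding E1_def
    by (intro compact_UN compact_continuous_image compact_Times compact_matrices assms finite)
      (intro continuous_on_vec_nth continuous_on_matrix_mult continuous_intros)
  define E2 where "E2 = insert 0 (insert 1 (E \<union> E1))"
  have "compact E2" unfolding E2_def using assms \<open>compact E1\<close> by (intro compact_insert compact_Un)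
  then have "compact (det ` ?M E2)"
    by (intro compact_continuous_image compact_matrices continuous_on_det continuous_on_id)
  then have "relcompact {z. z ^ CARD('n) \<in> det ` ?M E2}"
    by (rule relcompact_power_preimage) simp
  then obtain C where C: "compact C" "{z. z ^ CARD('n) \<in> det ` ?M E2} \<subseteq> C"
    unfolding relcompact_def by blast
  show ?thesis
  proof (intro exI[of _ C] conjI allI impI C(1))
    fix x :: "'a^'n^'n" and i j
    assume x: "det x = 1" and E': "\<forall>p q a b. p \<noteq> q \<longrightarrow> x $ a $ p * adjugate x $ q $ b \<in> E"
    have E: "x $ a $ p * adjugate x $ q $ b \<in> E" if "p \<noteq> q" for p q a b
      using E' that by blast
    define y where "y = adjugate x"
    have xy: "x ** y = mat 1" "y ** x = mat 1"
      using x by (simp_all add: y_def adjugate_left_inverse adjugate_right_inverse)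
    have "det x * det y = 1" using arg_cong[OF xy(1), of det] by (simp add: det_mul)
    then have dety: "det y = 1" using x by simp
    have diag: "x $ a $ p * y $ p $ b \<in> E2" for a p b
    proof (cases "\<exists>q. q \<noteq> p")
      case True
      then obtain q where q: "q \<noteq> p" by blast
      define M1 M2 :: "'a^'n^'n" where "M1 = (\<chi> a r. x $ a $ p * y $ q $ r)"
        and "M2 = (\<chi> r b. x $ r $ q * y $ p $ b)"
      have "(M1 ** M2) $ a $ b = (\<Sum>r\<in>UNIV. (x $ a $ p * y $ p $ b) * (y $ q $ r * x $ r $ q))"
        unfolding matrix_matrix_mult_def M1_def M2_def by (simp add: mult_ac)
      also have "\<dots> = (x $ a $ p * y $ p $ b) * (y ** x) $ q $ q"
        by (simp add: matrix_matrix_mult_def sum_distrib_left)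
      finally have "x $ a $ p * y $ p $ b = (M1 ** M2) $ a $ b"
        by (simp add: xy mat_def)
      moreover have "M1 \<in> ?M E" "M2 \<in> ?M E"
        using E q by (auto simp: M1_def M2_def y_def)
      ultimately have "x $ a $ p * y $ p $ b \<in> E1"
        unfolding E1_def by (intro UN_I[of a] UN_I[of b] image_eqI[of _ _ "(M1, M2)"]) auto
      then show ?thesis by (simp add: E2_def)
    next
      \<comment> \<open>In dimension one no second index exists; the product is an entry of the
        identity matrix, which is why 0 and 1 were put into \<open>E2\<close>.\<close>
      case False
      then have U: "(UNIV :: 'n set) = {p}" by auto
      have "x $ a $ p * y $ p $ b = (x ** y) $ a $ b"
        by (simp add: matrix_matrix_mult_def U)
      then show ?thesis by (simp add: xy mat_def E2_def)
    qed
    then have E2: "x $ a $ p * y $ q $ b \<in> E2" for a p q b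
      using E[of p q a b] by (cases "p = q") (auto simp: y_def E2_def)
    have "(x $ i $ j) ^ CARD('n) = det (\<chi> k. x $ i $ j *s y $ k)"
      using det_rows_mul[of "\<lambda>_. x $ i $ j" "\<lambda>k. y $ k"] dety by simp
    moreover have "(\<chi> k. x $ i $ j *s y $ k) \<in> ?M E2"
      using E2 by simp
    ultimately have "(x $ i $ j) ^ CARD('n) \<in> det ` ?M E2" by (rule image_eqI)
    with C(2) show "x $ i $ j \<in> C" by blast
  qed
qed

text \<open>Conjugation by a large transvection flattens \<open>1 + s m\<close> to a transvection, up to an error
  that vanishes with \<open>\<rho>\<close>.\<close>

lemma transvection_conjugate_nth:
  fixes \<tau> \<rho> c :: "'a::field" and M :: "'a^'n^'n"
  assumes "i \<noteq> j" "\<rho> \<noteq> 0" "c \<noteq> 0" and M: "M $ j $ i = 1"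
    and Y: "\<And>p q. Y $ p $ q = (if p = q then 1 else 0) + (- \<tau> * \<rho> ^ 2 / c) * (c * M $ p $ q)"
  shows "(transvection i j (1 / \<rho>) ** Y ** transvection i j (- (1 / \<rho>))) $ p $ q =
    transvection i j \<tau> $ p $ q
     - \<tau> * \<rho> * ((if p = i then M $ j $ q else 0) - (if q = j then M $ p $ i else 0))
     - \<tau> * \<rho> ^ 2 * M $ p $ q"
  unfolding mult_transvection_nth transvection_mult_nth Y transvection_nth
  using assms by (auto simp: field_simps power2_eq_square)

text \<open>\<open>\<V>\<close> stands for a neighbourhood base of the identity in a coarser group topology on \<open>G\<close>,
  which need not be Hausdorff; \<open>N\<close> below is the closure of the identity.\<close>

locale group_filter_base = special_linear H G
  for H :: "'a::local_field set" and G :: "('a^'n^'n) monoid" +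
  fixes \<V> :: "('a^'n^'n) set set"
  assumes V_subset: "V \<in> \<V> \<Longrightarrow> V \<subseteq> carrier G"
    and V_nhd: "V \<in> \<V> \<Longrightarrow> \<exists>U. open U \<and> mat 1 \<in> U \<and> U \<inter> carrier G \<subseteq> V"
    and V_nonempty: "\<V> \<noteq> {}"
    and V_Int: "V \<in> \<V> \<Longrightarrow> W \<in> \<V> \<Longrightarrow> \<exists>U\<in>\<V>. U \<subseteq> V \<inter> W"
    and V_div: "W \<in> \<V> \<Longrightarrow> \<exists>V\<in>\<V>. \<forall>x\<in>V. \<forall>y\<in>V. x ** adjugate y \<in> W"
    and V_conj: "W \<in> \<V> \<Longrightarrow> g \<in> carrier G \<Longrightarrow> \<exists>V\<in>\<V>. \<forall>x\<in>V. g ** x ** adjugate g \<in> W"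
begin

definition N where "N = \<Inter>\<V>"

lemma V_finite_Int:
  assumes "finite I" "\<And>i. i \<in> I \<Longrightarrow> W i \<in> \<V>"
  shows "\<exists>V\<in>\<V>. \<forall>i\<in>I. V \<subseteq> W i"
  using assms
proof (induction I rule: finite_induct)
  case empty
  then show ?case using V_nonempty by blast
next
  case (insert i I)
  then obtain V where V: "V \<in> \<V>" "\<forall>i\<in>I. V \<subseteq> W i" by auto
  moreover have "W i \<in> \<V>" using insert.prems by simp
  ultimately obtain U where "U \<in> \<V>" "U \<subseteq> V \<inter> W i" using V_Int by meson
  with V show ?case by (intro bexI[of _ U]) auto
qed

lemma mat_1_in_V: "V \<in> \<V> \<Longrightarrow> mat 1 \<in> V"
  using V_nhd mat_1_in_G by blast

lemma adjugate_adjugate: "x \<in> carrier G \<Longrightarrow> adjugate (adjugate x) = x"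
  using inv_inv[of x] adjugate_in_G by (simp add: G_inv)

lemma adjugate_unique:
  assumes "g \<in> carrier G" "g ** h = mat 1"
  shows "h = adjugate g"
proof -
  have "h = (adjugate g ** g) ** h"
    using assms by (simp add: adjugate_left_inverse G_carrier)
  also have "\<dots> = adjugate g" using assms by (simp flip: matrix_mul_assoc)
  finally show ?thesis .
qed

lemma V_mult:
  assumes "W \<in> \<V>"
  shows "\<exists>V\<in>\<V>. \<forall>x\<in>V. \<forall>y\<in>V. x ** y \<in> W"
proof -
  obtain W1 where W1: "W1 \<in> \<V>" "\<forall>x\<in>W1. \<forall>y\<in>W1. x ** adjugate y \<in> W"
    using V_div assms by blast
  obtain W2 where W2: "W2 \<in> \<V>" "\<forall>x\<in>W2. \<forall>y\<in>W2. x ** adjugate y \<in> W1"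
    using V_div W1(1) by blast
  obtain V where V: "V \<in> \<V>" "V \<subseteq> W1 \<inter> W2" using V_Int W1(1) W2(1) by blast
  have "x ** y \<in> W" if "x \<in> V" "y \<in> V" for x y
  proof -
    have "adjugate y \<in> W1" using W2(2) mat_1_in_V[OF W2(1)] that V by force
    then have "x ** adjugate (adjugate y) \<in> W" using W1(2) that V by blast
    then show ?thesis using V_subset[OF V(1)] that by (auto simp: adjugate_adjugate)
  qed
  with V(1) show ?thesis by blast
qed

text \<open>Unlike in \<open>V_conj\<close>, the conjugating element varies over the neighbourhood
  itself, so this comes from the continuity of products and quotients at the identity.\<close>

lemma V_conj_self:
  assumes "W \<in> \<V>"
  shows "\<exists>V\<in>\<V>. \<forall>x\<in>V. \<forall>u\<in>V. x ** u ** adjugate x \<in> W"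
proof -
  obtain W1 where W1: "W1 \<in> \<V>" "\<forall>x\<in>W1. \<forall>y\<in>W1. x ** adjugate y \<in> W"
    using V_div assms by blast
  obtain W2 where W2: "W2 \<in> \<V>" "\<forall>x\<in>W2. \<forall>y\<in>W2. x ** y \<in> W1"
    using V_mult W1(1) by blast
  obtain V where V: "V \<in> \<V>" "V \<subseteq> W1 \<inter> W2" using V_Int W1(1) W2(1) by blast
  then have "\<forall>x\<in>V. \<forall>u\<in>V. x ** u ** adjugate x \<in> W" using W1(2) W2(2) by blast
  with V(1) show ?thesis by blast
qed

lemma N_subset: "N \<subseteq> carrier G"
  using V_nonempty V_subset by (auto simp: N_def)

lemma mat_1_in_N: "mat 1 \<in> N"
  using mat_1_in_V by (auto simp: N_def)

lemma N_mult:
  assumes "x \<in> N" "y \<in> N"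
  shows "x ** y \<in> N"
  unfolding N_def
proof
  fix W assume "W \<in> \<V>"
  then obtain V where "V \<in> \<V>" "\<forall>x\<in>V. \<forall>y\<in>V. x ** y \<in> W" using V_mult by blast
  then show "x ** y \<in> W" using assms by (auto simp: N_def)
qed

lemma N_conj:
  assumes "g \<in> carrier G" "h \<in> carrier G" "g ** h = mat 1" "x \<in> N"
  shows "g ** x ** h \<in> N"
  unfolding N_def
proof
  fix W assume "W \<in> \<V>"
  then obtain V where "V \<in> \<V>" "\<forall>x\<in>V. g ** x ** adjugate g \<in> W" using V_conj assms(1) by blast
  moreover have "h = adjugate g" using assms by (intro adjugate_unique)
  ultimately show "g ** x ** h \<in> W" using assms(4) by (auto simp: N_def)
qed

lemma ex_transvection_notin_N:
  assumes "N \<noteq> carrier G" "i \<noteq> j"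
  shows "\<exists>t\<in>H. transvection i j t \<notin> N"
  using normal_containing_root_group[OF N_mult N_conj N_subset mat_1_in_N assms(2)] assms(1) by blast

text \<open>If \<open>y\<close> lies in \<open>W\<close> and \<open>e^-1 y\<close> does too, then
  \<open>e = y (e^-1 y)^-1\<close> is a quotient of two elements of \<open>W\<close>. The open set
  belongs to the finer topology of the matrix space, in which limits are computed.\<close>

lemma separated_from_N:
  assumes e: "e \<in> carrier G" "e \<notin> N"
  shows "\<exists>U W. open U \<and> e \<in> U \<and> W \<in> \<V> \<and> U \<inter> W = {}"
proof -
  obtain W0 where W0: "W0 \<in> \<V>" "e \<notin> W0" using e(2) by (auto simp: N_def)
  obtain W where W: "W \<in> \<V>" "\<forall>x\<in>W. \<forall>y\<in>W. x ** adjugate y \<in> W0"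
    using V_div W0(1) by blast
  obtain U where U: "open U" "mat 1 \<in> U" "U \<inter> carrier G \<subseteq> W" using V_nhd W(1) by blast
  define U' where "U' = (\<lambda>y. adjugate e ** y) -` U"
  have "open U'" unfolding U'_def
    by (intro open_vimage U(1) continuous_on_matrix_mult continuous_intros)
  moreover have "e \<in> U'" using U(2) e(1) by (simp add: U'_def adjugate_left_inverse G_carrier)
  moreover have "U' \<inter> W = {}"
  proof (rule ccontr)
    assume "U' \<inter> W \<noteq> {}"
    then obtain y where y: "y \<in> U'" "y \<in> W" by blast
    have yG: "y \<in> carrier G" using y V_subset W(1) by blast
    then have "adjugate e ** y \<in> W"
      using U(3) y e(1) adjugate_in_G by (auto simp: U'_def intro!: mult_in_G)
    then have "y ** adjugate (adjugate e ** y) \<in> W0" using W(2) y by blast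
    moreover have "adjugate (adjugate e ** y) = adjugate y ** e"
      using inv_mult_group[of "adjugate e" y] e(1) yG adjugate_in_G
      by (simp add: G_inv G_mult mult_in_G adjugate_adjugate)
    moreover have "y ** (adjugate y ** e) = e"
      using yG by (simp add: matrix_mul_assoc adjugate_right_inverse G_carrier)
    ultimately show False using W0(2) by simp
  qed
  ultimately show ?thesis using W(1) by blast
qed

lemma small_transvections_in_V:
  assumes "V \<in> \<V>"
  obtains S where "open S" "0 \<in> S"
    "\<And>p q s. p \<noteq> q \<Longrightarrow> s \<in> S \<Longrightarrow> s \<in> H \<Longrightarrow> transvection p q s \<in> V"
proof -
  obtain U where U: "open U" "mat 1 \<in> U" "U \<inter> carrier G \<subseteq> V" using V_nhd assms by blast
  define S where "S = (\<Inter>p. \<Inter>q. (\<lambda>s. transvection p q s :: 'a^'n^'n) -` U)"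
  have cont: "continuous_on UNIV (\<lambda>s. transvection p q s :: 'a^'n^'n)" for p q
  proof (intro continuous_on_vecI)
    fix i j
    show "continuous_on UNIV (\<lambda>s :: 'a. transvection p q s $ i $ j)"
      unfolding transvection_nth by (cases "i = p \<and> j = q") (auto intro!: continuous_intros)
  qed
  show thesis
  proof (rule that)
    show "open S" unfolding S_def
      by (intro open_INT finite ballI open_vimage U(1) cont)
    show "0 \<in> S" using U(2) by (simp add: S_def transvection_0)
    show "transvection p q s \<in> V" if "p \<noteq> q" "s \<in> S" "s \<in> H" for p q s
      using U(3) transvection_in_G[OF that(1,3)] that(2) by (auto simp: S_def)
  qed
qed

text \<open>If no \<open>V \<in> \<V>\<close> were bounded, some \<open>x E\<^sub>p\<^sub>q x\<inverse>\<close> with \<open>x \<in> V\<close> would be unbounded,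
  while \<open>1 + s x E\<^sub>p\<^sub>q x\<inverse> \<in> V V V\<inverse>\<close> for small \<open>s\<close>; after conjugation this would yield every
  element of a root group in the closure of the identity.\<close>

lemma ex_bounded_V:
  assumes inf: "infinite H" and N: "N \<noteq> carrier G"
  shows "\<exists>V\<in>\<V>. \<exists>C. compact C \<and> (\<forall>x\<in>V. \<forall>i j. x $ i $ j \<in> C)"
proof -
  define P where "P = {(i, j). i \<noteq> (j :: 'n)}"
  \<comment> \<open>The pivot position will depend on \<open>x\<close>. So a transvection outside
    \<open>N\<close> and sets separating it from \<open>N\<close> are fixed for every pair, and
    finiteness makes all choices simultaneous.\<close>
  have "\<forall>i j. \<exists>t. i \<noteq> j \<longrightarrow> t \<in> H \<and> transvection i j t \<notin> N"
    using ex_transvection_notin_N[OF N] by blast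
  then obtain \<tau> where \<tau>: "\<And>i j. i \<noteq> j \<Longrightarrow> \<tau> i j \<in> H" "\<And>i j. i \<noteq> j \<Longrightarrow> transvection i j (\<tau> i j) \<notin> N"
    by metis
  have "\<forall>i j. \<exists>U W. i \<noteq> j \<longrightarrow> open U \<and> transvection i j (\<tau> i j) \<in> U \<and> W \<in> \<V> \<and> U \<inter> W = {}"
    using separated_from_N[OF transvection_in_G \<tau>(2)] \<tau>(1) by meson
  then obtain U W where UW: "\<And>i j. i \<noteq> j \<Longrightarrow> open (U i j)" "\<And>i j. i \<noteq> j \<Longrightarrow> transvection i j (\<tau> i j) \<in> U i j"
    "\<And>i j. i \<noteq> j \<Longrightarrow> W i j \<in> \<V>" "\<And>i j. i \<noteq> j \<Longrightarrow> U i j \<inter> W i j = {}"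
    by metis
  obtain D :: "'a set" where D: "compact D" and pivot:
    "\<And>(m :: 'a^'n^'n) p q. p \<noteq> (q :: 'n) \<Longrightarrow> m ** m = 0 \<Longrightarrow>
       \<exists>j i. j \<noteq> i \<and> (\<forall>p q. \<exists>d\<in>D. m $ p $ q = m $ j $ i * d)"
  proof (cases "\<exists>i j :: 'n. i \<noteq> j")
    case True
    then obtain i j :: 'n where "i \<noteq> j" by blast
    then show thesis by (rule square_zero_pivot) (rule that)
  next
    case False
    \<comment> \<open>In dimension one there is no off-diagonal pair, and the requirement on
      \<open>D\<close> is vacuous.\<close>
    show thesis by (rule that[of "{}"]) (use False in auto)
  qed
  \<comment> \<open>The result of the coming conjugation as a function of \<open>\<rho>\<close> and
    of the matrix \<open>M\<close> normalised by its pivot. It is polynomial, and at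
    \<open>\<rho> = 0\<close> it is the chosen transvection for every \<open>M\<close>; compactness
    of \<open>?MD\<close> makes the approach uniform.\<close>
  define f where "f i j = (\<lambda>(\<rho>, M). (\<chi> p q. transvection i j (\<tau> i j) $ p $ q
     - \<tau> i j * \<rho> * ((if p = i then M $ j $ q else 0) - (if q = j then M $ p $ i else 0))
     - \<tau> i j * \<rho> ^ 2 * M $ p $ q) :: 'a^'n^'n)" for i j
  have f_cont: "continuous_on UNIV (f i j)" for i j
  proof (intro continuous_on_vecI)
    fix p q
    show "continuous_on UNIV (\<lambda>z. f i j z $ p $ q)"
      unfolding f_def case_prod_unfold
      by (cases "p = i"; cases "q = j") (auto intro!: continuous_intros continuous_on_vec_nth)
  qed
  let ?MD = "{M :: 'a^'n^'n. \<forall>i j. M $ i $ j \<in> D}"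
  have f0: "f i j (0, M) = transvection i j (\<tau> i j)" for i j M
    by (simp add: f_def vec_eq_iff)
  define good where "good i j R \<longleftrightarrow> (i \<noteq> j \<longrightarrow> open R \<and> 0 \<in> R \<and> (\<forall>\<rho>\<in>R. \<forall>M\<in>?MD. f i j (\<rho>, M) \<in> U i j))"
    for i j R
  have "\<exists>R. good i j R" for i j
  proof (cases "i = j")
    case False
    show ?thesis unfolding good_def
      by (rule nhd_mult_compact[OF compact_matrices[OF D] f_cont UW(1)[OF False], where a = 0])
        (use UW(2)[OF False] f0 in auto)
  qed (auto simp: good_def)
  then obtain R where "\<And>i j. good i j (R i j)" by metis
  then have R: "\<And>i j. i \<noteq> j \<Longrightarrow> open (R i j)" "\<And>i j. i \<noteq> j \<Longrightarrow> 0 \<in> R i j"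
    "\<And>i j \<rho> M. i \<noteq> j \<Longrightarrow> \<rho> \<in> R i j \<Longrightarrow> M \<in> ?MD \<Longrightarrow> f i j (\<rho>, M) \<in> U i j"
    unfolding good_def by blast+
  have "open (\<Inter>(i, j)\<in>P. R i j)"
    by (intro open_INT finite) (auto simp: P_def R)
  moreover have "0 \<in> (\<Inter>(i, j)\<in>P. R i j)" by (auto simp: P_def R)
  \<comment> \<open>\<open>\<rho>\<close> is taken in \<open>H\<close> because
    \<open>1 / \<rho>\<close> becomes the parameter of a conjugating element of \<open>G\<close>. It
    is fixed before \<open>V2\<close> and \<open>V\<close>, which are chosen to absorb that
    conjugation.\<close>
  ultimately obtain \<rho> where \<rho>: "\<rho> \<in> H" "\<rho> \<in> (\<Inter>(i, j)\<in>P. R i j)" "\<rho> \<noteq> 0"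
    using subfield_accumulates_at_zero[OF subfield inf] by metis
  define g where "g i j = (transvection i j (1 / \<rho>) :: 'a^'n^'n)" for i j
  have gG: "g i j \<in> carrier G" if "i \<noteq> j" for i j
    unfolding g_def using that \<rho>(1) by (intro transvection_in_G H_divide H_closed(2))
  have adj_g: "adjugate (g i j) = transvection i j (- (1 / \<rho>))" if "i \<noteq> j" for i j
    using adjugate_unique[OF gG[OF that]] transvection_inverse[OF that] by (metis g_def)
  have "\<forall>i j. \<exists>V. i \<noteq> j \<longrightarrow> V \<in> \<V> \<and> (\<forall>x\<in>V. g i j ** x ** adjugate (g i j) \<in> W i j)"
    using V_conj[OF UW(3) gG] by meson
  then obtain V1 where V1: "\<And>i j. i \<noteq> j \<Longrightarrow> V1 i j \<in> \<V>"
    "\<And>i j x. i \<noteq> j \<Longrightarrow> x \<in> V1 i j \<Longrightarrow> g i j ** x ** adjugate (g i j) \<in> W i j"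
    by metis
  obtain V2 where V2: "V2 \<in> \<V>" "\<And>i j. i \<noteq> j \<Longrightarrow> V2 \<subseteq> V1 i j"
    using V_finite_Int[of P "\<lambda>(i, j). V1 i j"] V1(1) by (force simp: P_def)
  obtain V where V: "V \<in> \<V>" "\<forall>x\<in>V. \<forall>u\<in>V. x ** u ** adjugate x \<in> V2"
    using V_conj_self[OF V2(1)] by blast
  obtain S where S: "open S" "0 \<in> S"
    "\<And>p q s. p \<noteq> q \<Longrightarrow> s \<in> S \<Longrightarrow> s \<in> H \<Longrightarrow> transvection p q s \<in> V"
    using small_transvections_in_V[OF V(1)] by blast
  \<comment> \<open>For nonzero \<open>c\<close> outside these sets,
    \<open>- \<tau> i j * \<rho>^2 / c\<close> is small enough to be the parameter of a transvection
    in \<open>V\<close>.\<close>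
  have "relcompact {c. inverse c \<notin> (\<lambda>z. - \<tau> i j * \<rho> ^ 2 * z) -` S}" for i j
    by (intro relcompact_inverse_not_in_nhd open_vimage S(1) continuous_intros) (use S(2) in simp)
  then have "relcompact ({0} \<union> (\<Union>i. \<Union>j. {c. inverse c \<notin> (\<lambda>z. - \<tau> i j * \<rho> ^ 2 * z) -` S}))"
    by (intro relcompact_Un[OF relcompact_finite] relcompact_UN) auto
  then obtain B where B: "compact B"
    "{0} \<union> (\<Union>i. \<Union>j. {c. inverse c \<notin> (\<lambda>z. - \<tau> i j * \<rho> ^ 2 * z) -` S}) \<subseteq> B"
    unfolding relcompact_def by blast
  define E where "E = (\<lambda>(x, y). x * y) ` (B \<times> D)"
  have "compact E" unfolding E_def by (intro compact_times_image B D)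
  from bounded_if_conjugates_bounded[OF this, where 'n = 'n]
  obtain C where C': "compact C \<and> (\<forall>x :: 'a^'n^'n. det x = 1 \<longrightarrow>
    (\<forall>p q a b. p \<noteq> q \<longrightarrow> x $ a $ p * adjugate x $ q $ b \<in> E) \<longrightarrow> (\<forall>i j. x $ i $ j \<in> C))" ..
  note C = conjunct1[OF C'] conjunct2[OF C']
  have "x $ a $ p * adjugate x $ q $ b \<in> E" if x: "x \<in> V" and pq: "p \<noteq> q" for x p q a b
  proof -
    have xG: "x \<in> carrier G" using x V_subset V(1) by blast
    have xy: "x ** adjugate x = mat 1" "adjugate x ** x = mat 1"
      using xG by (simp_all add: G_carrier adjugate_left_inverse adjugate_right_inverse)
    \<comment> \<open>The conjugate by \<open>x\<close> of the matrix unit at \<open>(p, q)\<close>;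
      it squares to zero because \<open>p \<noteq> q\<close>.\<close>
    define m :: "'a^'n^'n" where "m = (\<chi> a b. x $ a $ p * adjugate x $ q $ b)"
    have mH: "m $ a $ b \<in> H" for a b
      using xG adjugate_in_G[OF xG] by (auto simp: m_def G_carrier intro!: H_closed(5))
    have "(m ** m) $ a $ b = 0" for a b
    proof -
      have "(m ** m) $ a $ b = (x $ a $ p * adjugate x $ q $ b) * (adjugate x ** x) $ q $ p"
        by (simp add: matrix_matrix_mult_def m_def sum_distrib_left mult_ac)
      then show ?thesis using pq by (simp add: xy mat_def)
    qed
    then have "m ** m = 0" by (simp add: vec_eq_iff)
    then obtain j i where ji: "j \<noteq> i" "\<forall>p q. \<exists>d\<in>D. m $ p $ q = m $ j $ i * d"
      using pivot[OF pq] by blast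
    then obtain M0 where M0: "\<And>p q. M0 p q \<in> D" "\<And>p q. m $ p $ q = m $ j $ i * M0 p q"
      by metis
    define M :: "'a^'n^'n" where "M = (\<chi> p q. M0 p q)"
    define c where "c = m $ j $ i"
    have "M \<in> ?MD" by (simp add: M_def M0(1))
    moreover have "m $ p $ q = c * M $ p $ q" for p q
      unfolding M_def c_def vec_lambda_beta by (rule M0(2))
    ultimately have M: "M \<in> ?MD" "\<And>p q. m $ p $ q = c * M $ p $ q" by blast+
    have "c \<in> B"
    proof (rule ccontr)
      assume "c \<notin> B"
      then have c0: "c \<noteq> 0" and "- \<tau> i j * \<rho> ^ 2 * inverse c \<in> S" using B(2) by auto
      \<comment> \<open>Conjugating \<open>1 + s m\<close> by the transvection with parameter
        \<open>1 / \<rho>\<close> contributes \<open>- s * c / \<rho>^2\<close> at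
        \<open>(i, j)\<close>; this value of \<open>s\<close> makes it
        \<open>\<tau> i j\<close>.\<close>
      define s where "s = - \<tau> i j * \<rho> ^ 2 / c"
      have "s \<in> S" using \<open>- \<tau> i j * \<rho> ^ 2 * inverse c \<in> S\<close> by (simp add: s_def divide_inverse)
      moreover have "s \<in> H"
        using \<tau>(1)[of i j] ji(1) \<rho>(1) mH[of j i]
        by (auto simp: s_def c_def power2_eq_square intro!: H_divide H_closed)
      ultimately have "transvection p q s \<in> V" by (intro S(3) pq)
      define Y where "Y = x ** transvection p q s ** adjugate x"
      have "Y \<in> V2" unfolding Y_def using V(2) x \<open>transvection p q s \<in> V\<close> by blast
      then have "Y \<in> V1 i j" using V2(2)[of i j] ji(1) by blast
      then have inW: "g i j ** Y ** adjugate (g i j) \<in> W i j" using V1(2)[of i j Y] ji(1) by blast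
      have Y: "Y $ a $ b = (if a = b then 1 else 0) + (- \<tau> i j * \<rho> ^ 2 / c) * (c * M $ a $ b)" for a b
      proof -
        have "Y $ a $ b = (\<Sum>k\<in>UNIV. (x $ a $ k + (if k = q then x $ a $ p * s else 0)) * adjugate x $ k $ b)"
          unfolding Y_def by (subst matrix_matrix_mult_def) (simp add: mult_transvection_nth)
        also have "\<dots> = (x ** adjugate x) $ a $ b + s * m $ a $ b"
          by (simp add: matrix_matrix_mult_def distrib_right sum.distrib m_def
              if_distrib[of "\<lambda>x. x * _"] sum.delta' cong: if_cong)
        finally show ?thesis by (simp add: xy mat_def M(2) s_def)
      qed
      have "c * M $ j $ i = c" using M(2)[of j i] by (simp add: c_def)
      then have "M $ j $ i = 1" using c0 by simp
      then have "g i j ** Y ** adjugate (g i j) = f i j (\<rho>, M)"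
        using transvection_conjugate_nth[of i j \<rho> c M Y "\<tau> i j"] Y ji(1) \<rho>(3) c0
        by (simp add: f_def vec_eq_iff g_def[symmetric] adj_g[symmetric])
      also have "\<dots> \<in> U i j" using R(3) ji(1) \<rho>(2) M(1) by (auto simp: P_def)
      finally show False using inW UW(4)[of i j] ji(1) by blast
    qed
    then have "c * M $ a $ b \<in> E" unfolding E_def using M(1) by auto
    then show ?thesis using M(2)[of a b] by (simp add: m_def)
  qed
  then have "\<forall>x\<in>V. \<forall>i j. x $ i $ j \<in> C"
    using C(2) V_subset[OF V(1)] by (auto simp: G_carrier)
  with V(1) C(1) show ?thesis by blast
qed

end

section \<open>Limit points of bounded neighbourhoods\<close>

context special_linear
begin

lemma finite_carrier:
  assumes "finite H"
  shows "finite (carrier G)"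
proof (rule finite_subset)
  show "finite ((\<lambda>f. (\<chi> i j. f (i, j)) :: 'a^'n^'n) ` PiE (UNIV :: ('n \<times> 'n) set) (\<lambda>_. H))"
    using assms by (intro finite_imageI finite_PiE) auto
  show "carrier G \<subseteq> (\<lambda>f. (\<chi> i j. f (i, j)) :: 'a^'n^'n) ` PiE UNIV (\<lambda>_. H)"
  proof
    fix M assume "M \<in> carrier G"
    then show "M \<in> (\<lambda>f. (\<chi> i j. f (i, j)) :: 'a^'n^'n) ` PiE UNIV (\<lambda>_. H)"
      by (intro image_eqI[of _ _ "\<lambda>(i, j). M $ i $ j"]) (auto simp: vec_eq_iff G_carrier)
  qed
qed

end

text \<open>For nonzero \<open>b\<close> the inverse affine map would carry \<open>C\<close> to a
  compact set containing \<open>H\<close>.\<close>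

lemma affine_bounded_on_subfield:
  fixes H :: "'a::local_field set"
  assumes H: "subfield H ring_of_type_algebra" "infinite H"
    and C: "compact C" "\<And>t. t \<in> H \<Longrightarrow> a + t * b \<in> C"
  shows "b = 0"
proof (rule ccontr)
  assume b: "b \<noteq> 0"
  have "compact ((\<lambda>z. (z - a) * inverse b) ` C)"
    by (intro compact_continuous_image C(1) continuous_intros)
  moreover have "H \<subseteq> (\<lambda>z. (z - a) * inverse b) ` C"
  proof
    fix t assume "t \<in> H"
    then show "t \<in> (\<lambda>z. (z - a) * inverse b) ` C"
      using C(2) b by (intro image_eqI[of _ _ "a + t * b"]) auto
  qed
  ultimately show False
    using not_relcompact_subfield[OF H] relcompactI by blast
qed

context group_filter_base
begin

lemma closure_conj:
  assumes x: "x \<in> (\<Inter>V\<in>\<V>. closure V)" and g: "g \<in> carrier G"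
  shows "g ** x ** adjugate g \<in> (\<Inter>V\<in>\<V>. closure V)"
proof
  fix W assume "W \<in> \<V>"
  then obtain V where V: "V \<in> \<V>" "\<forall>x\<in>V. g ** x ** adjugate g \<in> W" using V_conj g by blast
  have "(\<lambda>x. g ** x ** adjugate g) ` closure V \<subseteq> closure W"
  proof (rule image_closure_subset)
    show "continuous_on (closure V) (\<lambda>x. g ** x ** adjugate g)"
      by (intro continuous_on_matrix_mult continuous_intros)
    show "(\<lambda>x. g ** x ** adjugate g) ` V \<subseteq> closure W"
      using V(2) closure_subset by blast
  qed simp
  moreover have "x \<in> closure V" using x V(1) by simp
  ultimately show "g ** x ** adjugate g \<in> closure W" by (simp add: image_subset_iff)
qed

lemma det_closure:
  assumes "V \<in> \<V>" "x \<in> closure V"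
  shows "det x = 1"
proof -
  have "closed (det -` {1} :: ('a^'n^'n) set)"
    by (intro closed_vimage continuous_on_det continuous_on_id) simp
  moreover have "V \<subseteq> det -` {1}" using V_subset[OF assms(1)] by (auto simp: G_carrier)
  ultimately have "closure V \<subseteq> det -` {1}" by (rule closure_minimal[rotated])
  then show ?thesis using assms(2) by auto
qed

text \<open>Closures are taken over the whole field and can leave \<open>G\<close> when
  \<open>H\<close> is not closed; those limits that lie in \<open>G\<close> are caught by the
  separation from \<open>N\<close>.\<close>

lemma closure_Int_carrier:
  assumes "x \<in> (\<Inter>V\<in>\<V>. closure V)" "x \<in> carrier G"
  shows "x \<in> N"
proof (rule ccontr)
  assume "x \<notin> N"
  then obtain U W where "open U" "x \<in> U" "W \<in> \<V>" "U \<inter> W = {}"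
    using separated_from_N assms(2) by blast
  then show False
    using assms(1) open_Int_closure_eq_empty[of U W] by blast
qed

text \<open>Conjugation by the transvection at \<open>(i, j)\<close> with parameter \<open>t\<close>
  adds \<open>t * x $ j $ i\<close> to the entry at \<open>(i, i)\<close>; boundedness over all
  \<open>t \<in> H\<close> makes \<open>x $ j $ i\<close> vanish. The entry at \<open>(i, j)\<close>
  then loses its quadratic term and is affine in \<open>t\<close>, with the difference of two
  diagonal entries as slope.\<close>

lemma closure_subset_scalars:
  assumes inf: "infinite H" and V0: "V0 \<in> \<V>" and C: "compact C" "\<forall>x\<in>V0. \<forall>i j. x $ i $ j \<in> C"
    and x: "x \<in> (\<Inter>V\<in>\<V>. closure V)"
  obtains l where "\<And>i j. x $ i $ j = (if i = j then l else 0)"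
proof -
  have "closed {M :: 'a^'n^'n. \<forall>i j. M $ i $ j \<in> C}"
    by (intro compact_imp_closed compact_matrices C(1))
  then have "closure V0 \<subseteq> {M. \<forall>i j. M $ i $ j \<in> C}"
    using C(2) by (intro closure_minimal) auto
  then have bounded: "y $ p $ q \<in> C" if "y \<in> (\<Inter>V\<in>\<V>. closure V)" for y p q
    using that V0 by blast
  have conj: "(transvection i j t ** x ** transvection i j (- t)) $ p $ q \<in> C"
    if "i \<noteq> j" "t \<in> H" for i j t p q
  proof -
    have "transvection i j (- t) = (adjugate (transvection i j t) :: 'a^'n^'n)"
      by (intro adjugate_unique transvection_in_G that transvection_inverse)
    then show ?thesis
      using bounded[OF closure_conj[OF x transvection_in_G[OF that]]] by simp
  qed
  have off: "x $ j $ i = 0" if "i \<noteq> j" for i j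
  proof (rule affine_bounded_on_subfield[OF subfield inf C(1)])
    fix t assume "t \<in> H"
    then show "x $ i $ i + t * x $ j $ i \<in> C"
      using conj[OF that, of t i i] that
      by (simp add: mult_transvection_nth transvection_mult_nth)
  qed
  have diag: "x $ j $ j = x $ i $ i" for i j
  proof (cases "i = j")
    case False
    have "x $ j $ j - x $ i $ i = 0"
    proof (rule affine_bounded_on_subfield[OF subfield inf C(1)])
      fix t assume "t \<in> H"
      then show "x $ i $ j + t * (x $ j $ j - x $ i $ i) \<in> C"
        using conj[OF False, of t i j] False off[OF False]
        by (simp add: mult_transvection_nth transvection_mult_nth algebra_simps)
    qed
    then show ?thesis by simp
  qed simp
  show thesis
    by (rule that[of "x $ undefined $ undefined"]) (use off diag in auto)
qed

theorem open_superset_of_N: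
  assumes roots: "\<And>z :: 'a. z ^ CARD('n) = 1 \<Longrightarrow> z = 1 \<or> z = - 1"
    and U: "open U" "N \<subseteq> U"
  shows "\<exists>V\<in>\<V>. V \<subseteq> U"
proof -
  consider "N = carrier G" | "finite H" | "infinite H" "N \<noteq> carrier G" by blast
  then show ?thesis
  proof cases
    case 1
    then show ?thesis using V_nonempty V_subset U by blast
  next
    \<comment> \<open>Here \<open>G\<close> is finite, so the members of \<open>\<V>\<close> are
      compact themselves and no closures are taken.\<close>
    case 2
    show ?thesis
    proof (rule compact_directed_subset)
      show "compact V" if "V \<in> \<V>" for V
        using that finite_carrier[OF 2] V_subset finite_subset finite_imp_compact by blast
      show "\<Inter>\<V> \<subseteq> U" using U(2) by (simp add: N_def)
    qed (use U V_nonempty V_Int in auto)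
  next
    case 3
    obtain V0 C where V0: "V0 \<in> \<V>" "compact C" "\<forall>x\<in>V0. \<forall>i j. x $ i $ j \<in> C"
      using ex_bounded_V[OF 3] by blast
    have closure_sub: "(\<Inter>V\<in>\<V>. closure V) \<subseteq> N"
    proof
      fix x assume x: "x \<in> (\<Inter>V\<in>\<V>. closure V)"
      obtain l where l: "\<And>i j. x $ i $ j = (if i = j then l else 0)"
        using closure_subset_scalars[OF 3(1) V0 x] by blast
      have "det x = 1" using x det_closure V0(1) by blast
      moreover have "det x = l ^ CARD('n)"
        by (subst det_diagonal) (simp_all add: l)
      \<comment> \<open>So far \<open>l\<close> is only an element of the large field. Being an n-th
        root of unity it is \<plusminus> 1, hence in every subfield; the condition on roots of unity
        is used here.\<close>
      ultimately have "l \<in> H" using roots[of l] H_closed(2,4) by auto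
      then have "x \<in> carrier G" using \<open>det x = 1\<close> by (simp add: G_carrier l H_closed)
      with x show "x \<in> N" by (rule closure_Int_carrier)
    qed
    \<comment> \<open>Closures of members inside the bounded \<open>V0\<close> are compact, and by
      directedness the restriction to them does not change the intersection.\<close>
    define F where "F = closure ` {V \<in> \<V>. V \<subseteq> V0}"
    have "\<exists>A\<in>F. A \<subseteq> U"
    proof (rule compact_directed_subset)
      have cMC: "compact {M :: 'a^'n^'n. \<forall>i j. M $ i $ j \<in> C}"
        by (intro compact_matrices V0)
      have closed: "closed {M :: 'a^'n^'n. \<forall>i j. M $ i $ j \<in> C}"
        using cMC by (rule compact_imp_closed)
      show "compact A" if A: "A \<in> F" for A
      proof -
        obtain V where V: "A = closure V" "V \<subseteq> V0" using A by (auto simp: F_def)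
        have "V \<subseteq> {M. \<forall>i j. M $ i $ j \<in> C}" using V(2) V0(3) by auto
        then have "A \<subseteq> {M. \<forall>i j. M $ i $ j \<in> C}"
          unfolding V(1) using closed by (rule closure_minimal)
        moreover have "compact ({M. \<forall>i j. M $ i $ j \<in> C} \<inter> A)"
          unfolding V(1) by (intro compact_Int_closed cMC closed_closure)
        ultimately show ?thesis by (simp add: inf.absorb2)
      qed
      show "F \<noteq> {}" using V0 by (auto simp: F_def)
      show "\<exists>D\<in>F. D \<subseteq> A \<inter> B" if AB: "A \<in> F" "B \<in> F" for A B
      proof -
        obtain V W where VW: "A = closure V" "V \<in> \<V>" "V \<subseteq> V0" "B = closure W" "W \<in> \<V>" "W \<subseteq> V0"
          using AB by (auto simp: F_def)
        obtain T where T: "T \<in> \<V>" "T \<subseteq> V \<inter> W" using V_Int VW by blast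
        then have "closure T \<subseteq> A \<inter> B" using VW closure_mono by blast
        moreover have "closure T \<in> F" using T VW by (auto simp: F_def)
        ultimately show ?thesis by blast
      qed
      have "\<Inter>F \<subseteq> (\<Inter>V\<in>\<V>. closure V)"
      proof (intro INT_greatest)
        fix V assume "V \<in> \<V>"
        then obtain T where T: "T \<in> \<V>" "T \<subseteq> V \<inter> V0" using V_Int V0(1) by blast
        then have "closure T \<in> F" by (auto simp: F_def)
        then show "\<Inter>F \<subseteq> closure V" using T(2) closure_mono[of T V] by blast
      qed
      then show "\<Inter>F \<subseteq> U" using closure_sub U(2) by blast
    qed (rule U)
    then obtain V where "V \<in> \<V>" "closure V \<subseteq> U" by (auto simp: F_def)
    then show ?thesis using closure_subset by blast
  qed
qed

end

section \<open>Quotients of topological groups\<close>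

locale topological_group = group G for G :: "('g, 'b) monoid_scheme" (structure) +
  fixes T :: "'g topology"
  assumes topological_group: "hausdorff_topological_group G T"
begin

lemma topspace_T: "topspace T = carrier G"
  and Hausdorff_T: "Hausdorff_space T"
  and continuous_mult: "continuous_map (prod_topology T T) T (\<lambda>(x, y). x \<otimes> y)"
  and continuous_inv: "continuous_map T T (\<lambda>x. inv x)"
  using topological_group by (auto simp: hausdorff_topological_group_def)

lemma continuous_mult':
  "continuous_map S T f \<Longrightarrow> continuous_map S T g \<Longrightarrow> continuous_map S T (\<lambda>x. f x \<otimes> g x)"
  using continuous_map_compose[OF continuous_map_pairedI continuous_mult] by (simp add: o_def)

lemma continuous_inv': "continuous_map S T f \<Longrightarrow> continuous_map S T (\<lambda>x. inv (f x))"
  using continuous_map_compose[OF _ continuous_inv] by (simp add: o_def)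

lemma continuous_right_translation:
  "a \<in> carrier G \<Longrightarrow> continuous_map T T (\<lambda>x. x \<otimes> a)"
  by (intro continuous_mult') (auto simp: topspace_T)

lemma continuous_conj:
  "a \<in> carrier G \<Longrightarrow> continuous_map T T (\<lambda>x. a \<otimes> x \<otimes> inv a)"
  by (intro continuous_mult') (auto simp: topspace_T)

lemma nhds_continuous2:
  assumes "continuous_map (prod_topology T T) T (\<lambda>(x, y). f x y)" "openin T W" "f x y \<in> W"
    "x \<in> carrier G" "y \<in> carrier G"
  shows "\<exists>U V. openin T U \<and> openin T V \<and> x \<in> U \<and> y \<in> V \<and> (\<forall>u\<in>U. \<forall>v\<in>V. f u v \<in> W)"
proof -
  have "openin (prod_topology T T) {p \<in> topspace (prod_topology T T). (\<lambda>(x, y). f x y) p \<in> W}"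
    using assms(1,2) by (rule openin_continuous_map_preimage)
  moreover have "(x, y) \<in> {p \<in> topspace (prod_topology T T). (\<lambda>(x, y). f x y) p \<in> W}"
    using assms by (simp add: topspace_T)
  ultimately have "\<exists>U V. openin T U \<and> openin T V \<and> x \<in> U \<and> y \<in> V \<and>
      U \<times> V \<subseteq> {p \<in> topspace (prod_topology T T). (\<lambda>(x, y). f x y) p \<in> W}"
    unfolding openin_prod_topology_alt by (elim allE impE) assumption
  then show ?thesis by (elim exE conjE) (intro exI conjI, assumption+, auto)
qed

lemma continuous_div: "continuous_map (prod_topology T T) T (\<lambda>(x, y). x \<otimes> inv y)"
  unfolding case_prod_unfold
  by (intro continuous_mult' continuous_inv' continuous_map_fst continuous_map_snd)

lemma continuous_left_div: "continuous_map (prod_topology T T) T (\<lambda>(x, y). inv x \<otimes> y)"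
  unfolding case_prod_unfold
  by (intro continuous_mult' continuous_inv' continuous_map_fst continuous_map_snd)

end

text \<open>\<open>Q\<close> is any surjective image of \<open>G\<close> rather than a group of
  cosets, so that a quotient of PSL, whose elements are cosets of cosets, is a quotient of SL by
  composition.\<close>

locale topological_quotient = topological_group G T
  for G :: "('g, 'b) monoid_scheme" (structure) and T +
  fixes Q :: "('h, 'c) monoid_scheme" and \<phi> :: "'g \<Rightarrow> 'h"
  assumes group_Q: "group Q" and hom: "\<phi> \<in> hom G Q" and surj: "\<phi> ` carrier G = carrier Q"
begin

sublocale hom: group_hom G Q \<phi>
  by (intro group_hom.intro group_hom_axioms.intro group_Q hom group_axioms)

lemma openin_quotient_iff:
  "openin (quotient_topology T \<phi>) U \<longleftrightarrow> U \<subseteq> carrier Q \<and> openin T {x \<in> carrier G. \<phi> x \<in> U}"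
  by (simp add: openin_quotient_topology topspace_T surj)

lemma topspace_quotient: "topspace (quotient_topology T \<phi>) = carrier Q"
  by (simp add: topspace_quotient_topology topspace_T surj)

text \<open>The saturation of \<open>U\<close> is a union of translates of \<open>U\<close> by
  elements of the kernel.\<close>

lemma openin_quotient_image:
  assumes U: "openin T U"
  shows "openin (quotient_topology T \<phi>) (\<phi> ` U)"
proof -
  have UG: "U \<subseteq> carrier G" using openin_subset[OF U] by (simp add: topspace_T)
  have "{x \<in> carrier G. \<phi> x \<in> \<phi> ` U} = (\<Union>k\<in>kernel G Q \<phi>. {x \<in> topspace T. x \<otimes> k \<in> U})"
  proof (intro equalityI subsetI)
    fix x assume "x \<in> {x \<in> carrier G. \<phi> x \<in> \<phi> ` U}"
    then obtain u where x: "x \<in> carrier G" "u \<in> U" "\<phi> x = \<phi> u" by auto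
    then have u: "u \<in> carrier G" using UG by blast
    have "inv x \<otimes> u \<in> kernel G Q \<phi>"
      using x u by (simp add: kernel_def hom.hom_inv hom.hom_mult)
    moreover have "x \<otimes> (inv x \<otimes> u) = u"
      using x u by (simp add: m_assoc[symmetric])
    ultimately show "x \<in> (\<Union>k\<in>kernel G Q \<phi>. {x \<in> topspace T. x \<otimes> k \<in> U})"
      using x by (intro UN_I[of "inv x \<otimes> u"]) (simp_all add: topspace_T)
  next
    fix x assume "x \<in> (\<Union>k\<in>kernel G Q \<phi>. {x \<in> topspace T. x \<otimes> k \<in> U})"
    then obtain k where k: "k \<in> carrier G" "\<phi> k = \<one>\<^bsub>Q\<^esub>" "x \<in> carrier G" "x \<otimes> k \<in> U"
      by (auto simp: kernel_def topspace_T)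
    then have "\<phi> x = \<phi> (x \<otimes> k)" by (simp add: hom.hom_mult)
    with k show "x \<in> {x \<in> carrier G. \<phi> x \<in> \<phi> ` U}" by blast
  qed
  moreover have "openin T (\<Union>k\<in>kernel G Q \<phi>. {x \<in> topspace T. x \<otimes> k \<in> U})"
    by (intro openin_Union ballI)
      (auto simp: kernel_def intro!: openin_continuous_map_preimage[OF _ U] continuous_right_translation)
  ultimately show ?thesis
    using UG surj by (auto simp: openin_quotient_iff)
qed

text \<open>A product of quotient maps need not be a quotient map, so continuity of multiplication
  uses that \<open>\<phi>\<close> is open; inversion follows from the universal property. For the
  separation, \<open>u\<close> and \<open>v\<close> have different images exactly when
  \<open>inv u \<otimes> v\<close> is in the open complement of the kernel.\<close>

lemma hausdorff_quotient:
  assumes closed: "closedin T (kernel G Q \<phi>)"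
  shows "hausdorff_topological_group Q (quotient_topology T \<phi>)"
  unfolding hausdorff_topological_group_def
proof (intro conjI group_Q topspace_quotient)
  let ?TQ = "quotient_topology T \<phi>"
  show "Hausdorff_space ?TQ"
    unfolding Hausdorff_space_def topspace_quotient
  proof (intro allI impI, elim conjE)
    fix a b assume "a \<in> carrier Q" "b \<in> carrier Q" and ab: "a \<noteq> b"
    then obtain x y where xy: "x \<in> carrier G" "y \<in> carrier G" "a = \<phi> x" "b = \<phi> y"
      using surj by blast
    have eq: "\<phi> u = \<phi> v \<longleftrightarrow> inv u \<otimes> v \<in> kernel G Q \<phi>" if "u \<in> carrier G" "v \<in> carrier G" for u v
      using that group.inv_equality[OF group_Q] group.inv_solve_left'[OF group_Q, of "\<one>\<^bsub>Q\<^esub>" "\<phi> u" "\<phi> v"]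
      by (auto simp: kernel_def hom.hom_inv hom.hom_mult)
    have op: "openin T (carrier G - kernel G Q \<phi>)"
      using closed by (metis closedin_def topspace_T)
    have mem: "inv x \<otimes> y \<in> carrier G - kernel G Q \<phi>"
      using eq ab xy by auto
    obtain U V where UV: "openin T U" "openin T V" "x \<in> U" "y \<in> V"
      "\<forall>u\<in>U. \<forall>v\<in>V. inv u \<otimes> v \<in> carrier G - kernel G Q \<phi>"
      using nhds_continuous2[OF continuous_left_div op mem xy(1,2)] by blast
    have "U \<subseteq> carrier G" "V \<subseteq> carrier G"
      using openin_subset[OF UV(1)] openin_subset[OF UV(2)] by (auto simp: topspace_T)
    then have "disjnt (\<phi> ` U) (\<phi> ` V)"
      using UV(5) eq by (auto simp: disjnt_iff subset_iff)
    then show "\<exists>U V. openin ?TQ U \<and> openin ?TQ V \<and> a \<in> U \<and> b \<in> V \<and> disjnt U V"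
      using UV xy by (intro exI[of _ "\<phi> ` U"] exI[of _ "\<phi> ` V"]) (auto intro: openin_quotient_image)
  qed
  show "continuous_map (prod_topology ?TQ ?TQ) ?TQ (\<lambda>(x, y). x \<otimes>\<^bsub>Q\<^esub> y)"
    unfolding continuous_map
  proof (intro conjI allI impI)
    show "(\<lambda>(x, y). x \<otimes>\<^bsub>Q\<^esub> y) ` topspace (prod_topology ?TQ ?TQ) \<subseteq> topspace ?TQ"
      using group_Q by (auto simp: topspace_quotient group.is_monoid monoid.m_closed)
    fix W assume W: "openin ?TQ W"
    show "openin (prod_topology ?TQ ?TQ)
        {p \<in> topspace (prod_topology ?TQ ?TQ). (case p of (x, y) \<Rightarrow> x \<otimes>\<^bsub>Q\<^esub> y) \<in> W}"
      unfolding openin_prod_topology_alt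
    proof (intro allI impI)
      fix a b
      assume "(a, b) \<in> {p \<in> topspace (prod_topology ?TQ ?TQ). (case p of (x, y) \<Rightarrow> x \<otimes>\<^bsub>Q\<^esub> y) \<in> W}"
      then have "a \<in> carrier Q" "b \<in> carrier Q" and ab: "a \<otimes>\<^bsub>Q\<^esub> b \<in> W"
        by (auto simp: topspace_quotient)
      then obtain x y where xy: "x \<in> carrier G" "y \<in> carrier G" "a = \<phi> x" "b = \<phi> y"
        using surj by blast
      have op: "openin T {z \<in> carrier G. \<phi> z \<in> W}" using W by (simp add: openin_quotient_iff)
      have mem: "x \<otimes> y \<in> {z \<in> carrier G. \<phi> z \<in> W}" using xy ab by (simp add: hom.hom_mult)
      obtain U V where UV: "openin T U" "openin T V" "x \<in> U" "y \<in> V"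
        "\<forall>u\<in>U. \<forall>v\<in>V. u \<otimes> v \<in> {z \<in> carrier G. \<phi> z \<in> W}"
        using nhds_continuous2[OF continuous_mult op mem xy(1,2)] by blast
      have UVG: "U \<subseteq> carrier G" "V \<subseteq> carrier G"
        using openin_subset[OF UV(1)] openin_subset[OF UV(2)] by (auto simp: topspace_T)
      have "\<phi> ` U \<times> \<phi> ` V \<subseteq> {p \<in> topspace (prod_topology ?TQ ?TQ). (case p of (x, y) \<Rightarrow> x \<otimes>\<^bsub>Q\<^esub> y) \<in> W}"
      proof (clarsimp simp: topspace_quotient)
        fix u v assume "u \<in> U" "v \<in> V"
        moreover from this have "u \<in> carrier G" "v \<in> carrier G" using UVG by auto
        ultimately show "\<phi> u \<in> carrier Q \<and> \<phi> v \<in> carrier Q \<and> \<phi> u \<otimes>\<^bsub>Q\<^esub> \<phi> v \<in> W"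
          using bspec[OF bspec[OF UV(5) \<open>u \<in> U\<close>] \<open>v \<in> V\<close>] by (simp add: hom.hom_mult)
      qed
      then show "\<exists>U V. openin ?TQ U \<and> openin ?TQ V \<and> a \<in> U \<and> b \<in> V \<and>
          U \<times> V \<subseteq> {p \<in> topspace (prod_topology ?TQ ?TQ). (case p of (x, y) \<Rightarrow> x \<otimes>\<^bsub>Q\<^esub> y) \<in> W}"
        using UV xy by (intro exI[of _ "\<phi> ` U"] exI[of _ "\<phi> ` V"]) (auto intro: openin_quotient_image)
    qed
  qed
  show "continuous_map ?TQ ?TQ (\<lambda>x. inv\<^bsub>Q\<^esub> x)"
  proof (rule continuous_compose_quotient_map_eq[OF quotient_map_quotient_topology, THEN iffD1])
    have "continuous_map T ?TQ (\<phi> \<circ> (\<lambda>x. inv x))"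
      using continuous_inv quotient_imp_continuous_map[OF quotient_map_quotient_topology]
      by (rule continuous_map_compose)
    then show "continuous_map T ?TQ ((\<lambda>x. inv\<^bsub>Q\<^esub> x) \<circ> \<phi>)"
      by (rule continuous_map_eq) (simp add: topspace_T hom.hom_inv)
  qed
qed

end

lemma topological_quotient_Mod:
  assumes "hausdorff_topological_group G T" "N \<lhd> G"
  shows "topological_quotient G T (G Mod N) (\<lambda>g. N #>\<^bsub>G\<^esub> g)"
    and "kernel G (G Mod N) (\<lambda>g. N #>\<^bsub>G\<^esub> g) = N"
proof -
  interpret normal N G by fact
  interpret topological_group G T by unfold_locales fact
  show "topological_quotient G T (G Mod N) (\<lambda>g. N #>\<^bsub>G\<^esub> g)"
    by (intro topological_quotient.intro topological_quotient_axioms.intro topological_group_axioms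
        factorgroup_is_group r_coset_hom_Mod carrier_FactGroup[symmetric])
  show "kernel G (G Mod N) (\<lambda>g. N #>\<^bsub>G\<^esub> g) = N"
  proof (intro equalityI subsetI)
    fix x assume "x \<in> kernel G (G Mod N) (\<lambda>g. N #>\<^bsub>G\<^esub> g)"
    then show "x \<in> N" using coset_join1[OF _ _ subgroup_axioms] by (simp add: kernel_def)
  next
    fix x assume "x \<in> N"
    then show "x \<in> kernel G (G Mod N) (\<lambda>g. N #>\<^bsub>G\<^esub> g)"
      using coset_join2[OF _ subgroup_axioms] mem_carrier by (simp add: kernel_def)
  qed
qed

lemma quotient_topology_compose:
  "quotient_topology (quotient_topology T f) g = quotient_topology T (g \<circ> f)"
proof -
  have "openin (quotient_topology (quotient_topology T f) g) U \<longleftrightarrow> openin (quotient_topology T (g \<circ> f)) U" for U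
  proof -
    have "{x \<in> topspace T. f x \<in> {x \<in> f ` topspace T. g x \<in> U}} = {x \<in> topspace T. g (f x) \<in> U}"
      by auto
    then show ?thesis
      by (auto simp: openin_quotient_topology topspace_quotient_topology image_comp)
  qed
  then show ?thesis by (simp add: topology_eq)
qed

lemma Hausdorff_space_euclidean_t2: "Hausdorff_space (euclidean :: 'a::t2_space topology)"
  unfolding Hausdorff_space_def disjnt_def
proof (intro allI impI, elim conjE)
  fix x y :: 'a
  assume "x \<noteq> y"
  then show "\<exists>U V. openin euclidean U \<and> openin euclidean V \<and> x \<in> U \<and> y \<in> V \<and> U \<inter> V = {}"
    using hausdorff[of x y] by (simp add: conj_assoc)
qed

lemma hausdorff_topological_group_SL:
  fixes H :: "'a::local_field set"
  assumes "subfield H ring_of_type_algebra"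
  shows "hausdorff_topological_group (SL H :: ('a^'n^'n) monoid) (SL_topology H)"
proof -
  interpret special_linear H "SL H :: ('a^'n^'n) monoid"
    by (intro special_linear.intro assms refl)
  let ?G = "SL H :: ('a^'n^'n) monoid"
  have "continuous_map (top_of_set (carrier ?G)) (top_of_set (carrier ?G)) adjugate"
    using adjugate_in_G by (auto intro!: continuous_on_adjugate continuous_on_id)
  then have "continuous_map (top_of_set (carrier ?G)) (top_of_set (carrier ?G)) (\<lambda>x. inv\<^bsub>?G\<^esub> x)"
    by (rule continuous_map_eq) (simp add: G_inv)
  moreover have "continuous_map (top_of_set (carrier ?G \<times> carrier ?G)) (top_of_set (carrier ?G)) (\<lambda>(x, y). x ** y)"
    using mult_in_G by (auto simp: case_prod_unfold intro!: continuous_on_matrix_mult continuous_intros)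
  ultimately show ?thesis
    by (simp add: hausdorff_topological_group_def SL_topology_def group_G G_mult
        Hausdorff_space_subtopology Hausdorff_space_euclidean_t2)
qed


section \<open>Minimality of the quotients\<close>

lemma (in topological_group) topological_group_nhds_of_one:
  assumes "openin T W" "\<one> \<in> W"
  obtains U where "openin T U" "\<one> \<in> U" "\<And>x y. x \<in> U \<Longrightarrow> y \<in> U \<Longrightarrow> x \<otimes> inv y \<in> W"
proof -
  have "\<one> \<otimes> inv \<one> \<in> W" using assms by simp
  from nhds_continuous2[OF continuous_div assms(1) this one_closed one_closed]
  obtain U V where "openin T U" "openin T V" "\<one> \<in> U" "\<one> \<in> V" "\<forall>u\<in>U. \<forall>v\<in>V. u \<otimes> inv v \<in> W"
    by (elim exE conjE)
  then show ?thesis by (intro that[of "U \<inter> V"]) auto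
qed

lemma minimal_group_quotient_SL:
  fixes H :: "'a::local_field set" and \<phi> :: "'a^'n^'n \<Rightarrow> 'h" and Q :: "('h, 'c) monoid_scheme"
  assumes H: "subfield H ring_of_type_algebra"
    and roots: "\<And>z :: 'a. z ^ CARD('n) = 1 \<Longrightarrow> z = 1 \<or> z = - 1"
    and quotient: "topological_quotient (SL H) (SL_topology H) Q \<phi>"
    and closed: "closedin (SL_topology H) (kernel (SL H) Q \<phi>)"
  shows "minimal_group Q (quotient_topology (SL_topology H) \<phi>)"
  unfolding minimal_group_def
proof (intro conjI allI impI, goal_cases)
  case 1
  show ?case using quotient closed by (rule topological_quotient.hausdorff_quotient)
next
  case (2 T')
  then have T': "hausdorff_topological_group Q T'"
    and coarser: "\<And>U. openin T' U \<Longrightarrow> openin (quotient_topology (SL_topology H) \<phi>) U" by auto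
  define G where "G = (SL H :: ('a^'n^'n) monoid)"
  interpret G: special_linear H G
    by (intro special_linear.intro H G_def)
  interpret q: topological_quotient G "SL_topology H" Q \<phi>
    using quotient by (simp add: G_def)
  interpret Q: topological_group Q T'
    by (intro topological_group.intro topological_group_axioms.intro q.group_Q T')
  have T: "SL_topology H = top_of_set (carrier G)" by (simp add: SL_topology_def G_def)
  define P where "P U = {x \<in> carrier G. \<phi> x \<in> U}" for U
  \<comment> \<open>A neighbourhood base of the identity for the pulled-back topology. Every member
    contains the kernel of \<open>\<phi>\<close>, so the base does not separate points in
    general.\<close>
  define \<V> where "\<V> = P ` {U. openin T' U \<and> \<one>\<^bsub>Q\<^esub> \<in> U}"
  have P_open: "\<exists>A. open A \<and> P U = A \<inter> carrier G" if "openin T' U" for U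
  proof -
    have "openin (top_of_set (carrier G)) (P U)"
      using coarser[OF that] unfolding q.openin_quotient_iff by (simp add: P_def T)
    then show ?thesis by (auto simp: openin_open Int_commute)
  qed
  have \<phi>_mult: "\<phi> (x ** y) = \<phi> x \<otimes>\<^bsub>Q\<^esub> \<phi> y" if "x \<in> carrier G" "y \<in> carrier G" for x y
    using q.hom.hom_mult[OF that] by (simp add: G.G_mult)
  have \<phi>_adjugate: "\<phi> (adjugate x) = inv\<^bsub>Q\<^esub> \<phi> x" if "x \<in> carrier G" for x
    using q.hom.hom_inv[OF that] that by (simp add: G.G_inv)
  have \<phi>_one: "\<phi> (mat 1) = \<one>\<^bsub>Q\<^esub>" using q.hom.hom_one by (simp add: G.G_one)
  interpret group_filter_base H G \<V>
  proof
    show "V \<subseteq> carrier G" if "V \<in> \<V>" for V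
      using that by (auto simp: \<V>_def P_def)
    show "\<exists>U. open U \<and> mat 1 \<in> U \<and> U \<inter> carrier G \<subseteq> V" if V: "V \<in> \<V>" for V
    proof -
      obtain U where U: "openin T' U" "\<one>\<^bsub>Q\<^esub> \<in> U" "V = P U" using V by (auto simp: \<V>_def)
      then have "mat 1 \<in> V" by (simp add: P_def \<phi>_one G.mat_1_in_G)
      then show ?thesis using P_open[OF U(1)] U(3) by auto
    qed
    show "\<V> \<noteq> {}"
      unfolding \<V>_def
      using Q.topspace_T openin_topspace[of T'] monoid.one_closed[OF group.is_monoid[OF q.group_Q]]
      by fastforce
    show "\<exists>U\<in>\<V>. U \<subseteq> V \<inter> W" if V: "V \<in> \<V>" and W: "W \<in> \<V>" for V W
    proof -
      obtain A B where AB: "openin T' A" "\<one>\<^bsub>Q\<^esub> \<in> A" "V = P A" "openin T' B" "\<one>\<^bsub>Q\<^esub> \<in> B" "W = P B"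
        using V W by (auto simp: \<V>_def)
      then have "P (A \<inter> B) \<in> \<V>" unfolding \<V>_def by (intro imageI) auto
      moreover have "P (A \<inter> B) \<subseteq> V \<inter> W" using AB by (auto simp: P_def)
      ultimately show ?thesis by blast
    qed
    show "\<exists>V\<in>\<V>. \<forall>x\<in>V. \<forall>y\<in>V. x ** adjugate y \<in> W" if W: "W \<in> \<V>" for W
    proof -
      obtain A where A: "openin T' A" "\<one>\<^bsub>Q\<^esub> \<in> A" "W = P A" using W by (auto simp: \<V>_def)
      obtain U where U: "openin T' U" "\<one>\<^bsub>Q\<^esub> \<in> U"
        "\<And>x y. x \<in> U \<Longrightarrow> y \<in> U \<Longrightarrow> x \<otimes>\<^bsub>Q\<^esub> inv\<^bsub>Q\<^esub> y \<in> A"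
        using Q.topological_group_nhds_of_one[OF A(1,2)] by metis
      have "P U \<in> \<V>" unfolding \<V>_def using U by (intro imageI) auto
      moreover have "x ** adjugate y \<in> W" if "x \<in> P U" "y \<in> P U" for x y
        using that U(3)[of "\<phi> x" "\<phi> y"] G.adjugate_in_G G.mult_in_G
        by (simp add: A(3) P_def \<phi>_mult \<phi>_adjugate)
      ultimately show ?thesis by blast
    qed
    show "\<exists>V\<in>\<V>. \<forall>x\<in>V. g ** x ** adjugate g \<in> W" if W: "W \<in> \<V>" and g: "g \<in> carrier G" for W g
    proof -
      obtain A where A: "openin T' A" "\<one>\<^bsub>Q\<^esub> \<in> A" "W = P A" using W by (auto simp: \<V>_def)
      define U where "U = {x \<in> topspace T'. \<phi> g \<otimes>\<^bsub>Q\<^esub> x \<otimes>\<^bsub>Q\<^esub> inv\<^bsub>Q\<^esub> \<phi> g \<in> A}"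
      have "openin T' U" unfolding U_def
        using g by (intro openin_continuous_map_preimage[OF Q.continuous_conj A(1)]) auto
      moreover have "\<one>\<^bsub>Q\<^esub> \<in> U" using A(2) g by (simp add: U_def Q.topspace_T)
      ultimately have "P U \<in> \<V>" unfolding \<V>_def by (intro imageI) auto
      moreover have "g ** x ** adjugate g \<in> W" if "x \<in> P U" for x
        using that g G.adjugate_in_G G.mult_in_G
        by (simp add: A(3) P_def U_def \<phi>_mult \<phi>_adjugate)
      ultimately show ?thesis by blast
    qed
  qed
  \<comment> \<open>Hausdorffness of \<open>T'\<close> enters here: it confines the closure of the
    identity to the kernel.\<close>
  have N: "\<phi> x = \<one>\<^bsub>Q\<^esub>" if x: "x \<in> N" for x
  proof (rule ccontr)
    assume ne: "\<phi> x \<noteq> \<one>\<^bsub>Q\<^esub>"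
    have "x \<in> carrier G" using x N_subset by blast
    then have "\<exists>U V. openin T' U \<and> openin T' V \<and> \<phi> x \<in> U \<and> \<one>\<^bsub>Q\<^esub> \<in> V \<and> disjnt U V"
      using Q.Hausdorff_T ne unfolding Hausdorff_space_def by (simp add: Q.topspace_T)
    then obtain U V where UV: "openin T' V" "\<phi> x \<in> U" "\<one>\<^bsub>Q\<^esub> \<in> V" "disjnt U V" by blast
    then have "P V \<in> \<V>" unfolding \<V>_def by (intro imageI) auto
    then have "x \<in> P V" using x by (auto simp: N_def)
    then show False using UV by (auto simp: P_def disjnt_iff)
  qed
  have "openin T' U" if U: "openin (quotient_topology (SL_topology H) \<phi>) U" for U
  proof (subst openin_subopen, intro ballI)
    fix b assume b: "b \<in> U"
    then obtain g where g: "g \<in> carrier G" "b = \<phi> g"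
      using U q.surj by (auto simp: q.openin_quotient_iff)
    have "openin (SL_topology H) {x \<in> carrier G. \<phi> x \<in> U}" using U by (simp add: q.openin_quotient_iff)
    then obtain A where A: "open A" "{x \<in> carrier G. \<phi> x \<in> U} = carrier G \<inter> A"
      unfolding T openin_open by blast
    \<comment> \<open>The translate of \<open>A\<close> by the inverse of \<open>g\<close>. On
      \<open>G\<close> the set \<open>A\<close> is saturated under \<open>\<phi>\<close>, so
      \<open>A'\<close> contains \<open>N\<close> and hence a member of \<open>\<V>\<close>;
      translating back by \<open>b\<close> gives the \<open>T'\<close>-neighbourhood
      \<open>B\<close>.\<close>
    define A' where "A' = (\<lambda>x. x ** g) -` A"
    have "open A'" unfolding A'_def
      by (intro open_vimage A(1) continuous_on_matrix_mult continuous_intros)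
    moreover have "N \<subseteq> A'"
    proof
      fix x assume x: "x \<in> N"
      then have xG: "x \<in> carrier G" using N_subset by blast
      then have "\<phi> (x ** g) \<in> U" using N[OF x] b g by (simp add: \<phi>_mult)
      then show "x \<in> A'" using A(2) G.mult_in_G[OF xG g(1)] by (auto simp: A'_def)
    qed
    ultimately obtain V where V: "V \<in> \<V>" "V \<subseteq> A'" using open_superset_of_N[OF roots] by blast
    then obtain O' where O': "openin T' O'" "\<one>\<^bsub>Q\<^esub> \<in> O'" "V = P O'" by (auto simp: \<V>_def)
    define B where "B = {x \<in> topspace T'. x \<otimes>\<^bsub>Q\<^esub> inv\<^bsub>Q\<^esub> b \<in> O'}"
    have "b \<in> carrier Q" using g by simp
    then have "openin T' B" unfolding B_def
      by (intro openin_continuous_map_preimage[OF Q.continuous_right_translation O'(1)]) auto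
    moreover have "b \<in> B" using O'(2) \<open>b \<in> carrier Q\<close> by (simp add: B_def Q.topspace_T)
    moreover have "B \<subseteq> U"
    proof
      fix c assume c: "c \<in> B"
      then obtain z where z: "z \<in> carrier G" "c = \<phi> z"
        using q.surj by (auto simp: B_def Q.topspace_T)
      then have "z ** adjugate g \<in> V"
        using c g G.adjugate_in_G G.mult_in_G by (simp add: O'(3) P_def B_def \<phi>_mult \<phi>_adjugate)
      then have "z ** adjugate g ** g \<in> A" using V(2) by (auto simp: A'_def)
      then have "z \<in> A"
        using g by (simp add: matrix_mul_assoc[symmetric] adjugate_left_inverse G.G_carrier)
      with A(2) z show "c \<in> U" by auto
    qed
    ultimately show "\<exists>S. openin T' S \<and> b \<in> S \<and> S \<subseteq> U" by blast
  qed
  with coarser show "T' = quotient_topology (SL_topology H) \<phi>"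
    by (auto simp: topology_eq)
qed

text \<open>The center hypothesis enters as a condition on n-th roots of unity, a form that can be
  checked in each of the three situations of the theorem.\<close>

lemma totally_minimal_SL_PSL:
  fixes H :: "'a::local_field set"
  assumes H: "subfield H ring_of_type_algebra"
    and roots: "\<And>z :: 'a. z ^ CARD('n) = 1 \<Longrightarrow> z = 1 \<or> z = - 1"
  shows "totally_minimal_group (SL H :: ('a^'n^'n) monoid) (SL_topology H)"
    and "totally_minimal_group (PSL H :: ('a^'n^'n) set monoid) (PSL_topology H)"
proof -
  let ?G = "SL H :: ('a^'n^'n) monoid" and ?T = "SL_topology H :: ('a^'n^'n) topology"
  note htg = hausdorff_topological_group_SL[OF H, where 'n = 'n]
  show "totally_minimal_group ?G ?T"
    unfolding totally_minimal_group_def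
  proof (intro conjI allI impI htg)
    fix N assume N: "N \<lhd> ?G \<and> closedin ?T N"
    show "minimal_group (?G Mod N) (quotient_group_topology ?G ?T N)"
      by (rule minimal_group_quotient_SL[OF H roots])
        (use topological_quotient_Mod[OF htg] N in auto)
  qed
  define Z where "Z = group_center ?G"
  interpret special_linear H ?G
    by (intro special_linear.intro H refl)
  have comm: "z \<otimes>\<^bsub>?G\<^esub> g = g \<otimes>\<^bsub>?G\<^esub> z" if "z \<in> Z" "g \<in> carrier ?G" for z g
    using that by (simp add: Z_def group_center_def)
  have ZG: "Z \<subseteq> carrier ?G" by (auto simp: Z_def group_center_def)
  have "subgroup Z ?G"
  proof (rule subgroupI)
    show "inv\<^bsub>?G\<^esub> z \<in> Z" if z: "z \<in> Z" for z
    proof -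
      have "inv\<^bsub>?G\<^esub> z \<otimes>\<^bsub>?G\<^esub> g = g \<otimes>\<^bsub>?G\<^esub> inv\<^bsub>?G\<^esub> z" if g: "g \<in> carrier ?G" for g
      proof -
        have "inv\<^bsub>?G\<^esub> (inv\<^bsub>?G\<^esub> g \<otimes>\<^bsub>?G\<^esub> z) = inv\<^bsub>?G\<^esub> (z \<otimes>\<^bsub>?G\<^esub> inv\<^bsub>?G\<^esub> g)"
          using comm[OF z, of "inv\<^bsub>?G\<^esub> g"] g by simp
        moreover have "z \<in> carrier ?G" using z ZG by blast
        ultimately show ?thesis using g by (simp add: inv_mult_group)
      qed
      then show ?thesis using z by (auto simp: Z_def group_center_def)
    qed
  next
    show "x \<otimes>\<^bsub>?G\<^esub> y \<in> Z" if "x \<in> Z" "y \<in> Z" for x y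
    proof -
      have "x \<in> carrier ?G" "y \<in> carrier ?G" using that ZG by auto
      moreover from this have "(x \<otimes>\<^bsub>?G\<^esub> y) \<otimes>\<^bsub>?G\<^esub> g = g \<otimes>\<^bsub>?G\<^esub> (x \<otimes>\<^bsub>?G\<^esub> y)" if "g \<in> carrier ?G" for g
        using comm[OF \<open>x \<in> Z\<close> that] comm[OF \<open>y \<in> Z\<close> that] that by (metis m_assoc)
      ultimately show ?thesis by (auto simp: Z_def group_center_def)
    qed
    have "\<one>\<^bsub>?G\<^esub> \<in> Z" by (auto simp: Z_def group_center_def)
    then show "Z \<noteq> {}" by blast
  qed (rule ZG)
  moreover have "x \<otimes>\<^bsub>?G\<^esub> z \<otimes>\<^bsub>?G\<^esub> inv\<^bsub>?G\<^esub> x = z" if "x \<in> carrier ?G" "z \<in> Z" for x z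
    using that ZG comm[OF that(2,1), symmetric] by (auto simp: m_assoc)
  ultimately have Z: "Z \<lhd> ?G"
    by (simp add: normal_inv_iff)
  \<comment> \<open>The center is cut out by the equations \<open>z ** g = g ** z\<close>, which are
    closed conditions in the Hausdorff space of matrices.\<close>
  have "carrier ?G \<inter> (\<Inter>g\<in>carrier ?G. {z. z ** g = g ** z}) = Z"
    by (auto simp: Z_def group_center_def G_mult)
  moreover have "closed (\<Inter>g\<in>carrier ?G. {z :: 'a^'n^'n. z ** g = g ** z})"
    by (intro closed_INT ballI closed_Collect_eq continuous_on_matrix_mult continuous_intros)
  ultimately have Z_closed: "closedin ?T Z"
    unfolding SL_topology_def by (metis closedin_closed_Int[of "\<Inter>g\<in>carrier ?G. {z. z ** g = g ** z}" "carrier ?G"])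
  define \<pi> where "\<pi> = (\<lambda>g. Z #>\<^bsub>?G\<^esub> g)"
  let ?P = "PSL H :: ('a^'n^'n) set monoid"
  have PSL: "?P = ?G Mod Z" "PSL_topology H = quotient_topology ?T \<pi>"
    by (simp_all add: PSL_def PSL_topology_def Z_def \<pi>_def)
  have q1: "topological_quotient ?G ?T ?P \<pi>" and ker1: "kernel ?G ?P \<pi> = Z"
    using topological_quotient_Mod[OF htg Z] by (simp_all add: PSL \<pi>_def)
  interpret q1: topological_quotient ?G ?T ?P \<pi> by (rule q1)
  have htgP: "hausdorff_topological_group ?P (PSL_topology H)"
    unfolding PSL(2) by (rule q1.hausdorff_quotient) (simp add: ker1 Z_closed)
  show "totally_minimal_group ?P (PSL_topology H)"
    unfolding totally_minimal_group_def
  proof (intro conjI allI impI htgP)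
    fix N assume N: "N \<lhd> ?P \<and> closedin (PSL_topology H) N"
    define \<psi> where "\<psi> = (\<lambda>g. N #>\<^bsub>?P\<^esub> g)"
    have q2: "topological_quotient ?P (PSL_topology H) (?P Mod N) \<psi>" and ker2: "kernel ?P (?P Mod N) \<psi> = N"
      using topological_quotient_Mod[OF htgP, of N] N by (simp_all add: \<psi>_def)
    interpret q2: topological_quotient ?P "PSL_topology H" "?P Mod N" \<psi> by (rule q2)
    \<comment> \<open>A quotient of PSL is turned into a quotient of SL; its kernel is the preimage
      of \<open>N\<close> and therefore closed.\<close>
    have "\<psi> \<circ> \<pi> \<in> hom ?G (?P Mod N)" using q1.hom q2.hom by (rule Group.hom_compose)
    moreover have "(\<psi> \<circ> \<pi>) ` carrier ?G = carrier (?P Mod N)"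
      by (simp only: image_comp[symmetric] q1.surj q2.surj)
    ultimately have q: "topological_quotient ?G ?T (?P Mod N) (\<psi> \<circ> \<pi>)"
      by (intro topological_quotient.intro topological_quotient_axioms.intro
          q1.topological_group_axioms q2.group_Q)
    have "kernel ?G (?P Mod N) (\<psi> \<circ> \<pi>) = {x \<in> topspace ?T. \<pi> x \<in> kernel ?P (?P Mod N) \<psi>}"
      by (auto simp: kernel_def q1.topspace_T)
    moreover have "closedin ?T {x \<in> topspace ?T. \<pi> x \<in> kernel ?P (?P Mod N) \<psi>}"
      unfolding ker2 using N
      by (intro closedin_continuous_map_preimage[where Y = "PSL_topology H"])
        (auto simp: PSL(2) intro: quotient_imp_continuous_map quotient_map_quotient_topology)
    ultimately have "minimal_group (?P Mod N) (quotient_topology ?T (\<psi> \<circ> \<pi>))"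
      by (intro minimal_group_quotient_SL[OF H roots q]) auto
    then show "minimal_group (?P Mod N) (quotient_group_topology ?P (PSL_topology H) N)"
      by (simp add: PSL(2) quotient_topology_compose \<psi>_def)
  qed
qed

text \<open>The scalar matrix of an n-th root of unity has determinant 1 and commutes with
  everything, so it is a central element.\<close>

lemma roots_of_unity_if_center_SL:
  fixes z :: "'a::field"
  assumes center: "group_center (SL (UNIV :: 'a set) :: ('a^'n^'n) monoid) \<subseteq> {mat 1, - mat 1}"
    and z: "z ^ CARD('n) = 1"
  shows "z = 1 \<or> z = - 1"
proof -
  have "det (mat z :: 'a^'n^'n) = 1"
    using z by (subst det_diagonal) (simp_all add: mat_def)
  moreover have "mat z ** A = A ** mat z" for A :: "'a^'n^'n"
    by (simp add: vec_eq_iff matrix_matrix_mult_def mat_def if_distrib[of "\<lambda>x. x * _"]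
        if_distrib[of "\<lambda>x. _ * x"] cong: if_cong)
  ultimately have "(mat z :: 'a^'n^'n) \<in> group_center (SL UNIV)"
    by (simp add: group_center_def SL_def)
  with center have "(mat z :: 'a^'n^'n) = mat 1 \<or> (mat z :: 'a^'n^'n) = - mat 1" by blast
  \<comment> \<open>\<open>undefined\<close> is just some index; one diagonal entry determines a
    scalar matrix.\<close>
  then have "(mat z :: 'a^'n^'n) $ undefined $ undefined = (mat 1 :: 'a^'n^'n) $ undefined $ undefined \<or>
      (mat z :: 'a^'n^'n) $ undefined $ undefined = (- mat 1 :: 'a^'n^'n) $ undefined $ undefined"
    by metis
  then show ?thesis by (simp add: mat_def)
qed

theorem corollary4p8:
  shows "(group_center (SL (UNIV :: 'a::local_field set) :: ('a^'n::finite^'n) monoid)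
            \<subseteq> {mat 1, - mat 1} \<longrightarrow>
          (\<forall>H :: 'a set. subfield H ring_of_type_algebra \<longrightarrow>
             totally_minimal_group (PSL H :: ('a^'n^'n) set monoid) (PSL_topology H) \<and>
             totally_minimal_group (SL H :: ('a^'n^'n) monoid) (SL_topology H)))
       \<and> (\<forall>H :: 'a set. subfield H ring_of_type_algebra \<longrightarrow>
             totally_minimal_group (SL H :: ('a^2^2) monoid) (SL_topology H) \<and>
             totally_minimal_group (PSL H :: ('a^2^2) set monoid) (PSL_topology H))
       \<and> (\<forall>H :: real set. subfield H ring_of_type_algebra \<longrightarrow>
             totally_minimal_group (SL H :: (real^'n^'n) monoid) (SL_topology H) \<and>
             totally_minimal_group (PSL H :: (real^'n^'n) set monoid) (PSL_topology H))"
proof (intro conjI allI impI)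
  fix H :: "'a set"
  assume center: "group_center (SL (UNIV :: 'a set) :: ('a^'n^'n) monoid) \<subseteq> {mat 1, - mat 1}"
    and H: "subfield H ring_of_type_algebra"
  show "totally_minimal_group (PSL H :: ('a^'n^'n) set monoid) (PSL_topology H)"
    and "totally_minimal_group (SL H :: ('a^'n^'n) monoid) (SL_topology H)"
    using totally_minimal_SL_PSL[OF H] roots_of_unity_if_center_SL[OF center] by blast+
next
  fix H :: "'a set"
  assume H: "subfield H ring_of_type_algebra"
  \<comment> \<open>The equation \<open>z^2 = 1\<close> factors over any field; in characteristic
    two both roots coincide.\<close>
  have "z = 1 \<or> z = - 1" if "z ^ CARD(2) = 1" for z :: 'a
    using that by (simp add: power2_eq_1_iff)
  with totally_minimal_SL_PSL[OF H]
  show "totally_minimal_group (SL H :: ('a^2^2) monoid) (SL_topology H)"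
    and "totally_minimal_group (PSL H :: ('a^2^2) set monoid) (PSL_topology H)"
    by blast+
next
  fix H :: "real set"
  assume H: "subfield H ring_of_type_algebra"
  \<comment> \<open>A real root of unity has absolute value 1.\<close>
  have "z = 1 \<or> z = - 1" if "z ^ CARD('n) = 1" for z :: real
    using power_eq_1_iff[OF that] by auto
  with totally_minimal_SL_PSL[OF H]
  show "totally_minimal_group (SL H :: (real^'n^'n) monoid) (SL_topology H)"
    and "totally_minimal_group (PSL H :: (real^'n^'n) set monoid) (PSL_topology H)"
    by blast+
qed

end
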